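(* Let the graph $G=(V,\vec E)$ be a graphical representation of the Linear Dynamic Influence Model (LDIM) $(Q(\mathbf z),e)$, and let $y_I,y_Z,y_J$ be disjoint subsets of $V$. If the LDIM is causal, then $$dsep_G(y_I,y_Z,y_J)\ \Rightarrow\ cwsep(y_I,y_Z,y_J),$$ that is, if $y_Z$ $d$-separates $y_I$ and $y_J$ in $G$, then $y_I$ is causally Wiener-separated from $y_J$ by $y_Z$.
   Context: **Transfer functions.** $\mathcal F$ is the set of real-rational transfer functions that are analytic and invertible on the unit circle $\{|\mathbf z|=1\}$; the zero transfer function is also admitted. Each $P\in\mathcal F$ is uniquely represented by a bi-infinite sequence $p_k$ with $P(\mathbf z)=\sum_{k=-\infty}^{\infty}p_k\mathbf z^{-k}$ for all $|\mathbf z|=1$; $P$ is causal if $p_k=0$ for $k<0$, and $\mathcal F^+$ is the set of causal transfer functions. $P(\mathbf z)u$ denotes the process $t\mapsto\sum_k p_{t-k}u(k)$. **LDIM.** A network $y=Q(\mathbf z)y+P(\mathbf z)u$ with $n$ output nodes $y=(y_1^T,\dots,y_n^T)^T$ and $n$ wide-sense stationary inputs $u=(u_1^T,\dots,u_n^T)^T$, where $Q(\mathbf z)\in\mathcal F^{n\times n}$ and $P(\mathbf z)\in(\mathcal F^+)^{n\times n}$ are stable $(n\times n)$-block matrices, the power spectral density of $u$ is $\Phi_u(\mathbf z)=\mathcal I$ (identity), and $P(\mathbf z)$ is block diagonal. Setting $e=P(\mathbf z)u$, the spectral density $\Phi_e$ is block diagonal, the dynamics is $y=Q(\mathbf z)y+e$,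 and the LDIM is denoted by the pair $(Q(\mathbf z),e)$. The LDIM is causal if all entries of $Q(\mathbf z)$ are causal. **Graphical representation.** A directed graph $G=(V,\vec E)$ with $V=\{y_1,\dots,y_n\}$ such that $(y_i,y_j)\notin\vec E$ implies $Q_{ji}(\mathbf z)=0$ (an edge may correspond to a zero transfer function). **$d$-separation.** A path between two vertices is an ordered sequence of distinct ordered pairs of nodes $(y_{\pi_1},y_{\pi_2}),\dots,(y_{\pi_{\ell-1}},y_{\pi_\ell})$ joining them, with $(y_{\pi_p},y_{\pi_{p+1}})\in\vec E$ or $(y_{\pi_{p+1}},y_{\pi_p})\in\vec E$ for each $p$. A node $y_{\pi_p}$, $1<p<\ell$, is a collider on the path if $y_{\pi_{p-1}}\to y_{\pi_p}\leftarrow y_{\pi_{p+1}}$ appears in it. The descendants of a node are the node itself and all nodes reachable from it by a directed chain of edges. For mutually disjoint $y_I,y_Z,y_J\subseteq V$, $dsep_G(y_I,y_Z,y_J)$ ($y_Z$ $d$-separates $y_I$ and $y_J$) means that every path between a node of $y_I$ and a node of $y_J$ either contains a node of $y_Z$ that is not a collider, or contains a collider such that neither it nor any of its descendants belongs to $y_Z$. **Causal Wiener filter and causal Wiener separation.** For jointly stationary processes with rational spectral densities, $\mathrm{ctfspan}\{y_1,\dots,y_m\}=\{\sum_i P_i(\mathbf z)y_i : P_i\in\mathcal F^+\}$. The causal Wiener estimate of $x$ from $y$ is the unique minimizer $W^C_{x|y}(\mathbf z)y$ of $\mathbf E[(x-q)^T(x-q)]$ over $q\in\mathrm{ctfspan}\{y_1,\dots,y_m\}$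 (the filter $W^C_{x|y}$ itself is unique if $\Phi_y(e^{i\omega})\succ0$ for $\omega\in[-\pi,\pi]$). For disjoint sets, $cwsep(y_I,y_Z,y_J)$ denotes that the component $W^C_{y_J,[y_I]|(y_I,y_Z)}(\mathbf z)$ of the causal Wiener filter $W^C_{y_J|(y_I,y_Z)}$ associated with $y_I$ is zero. This is the causal analogue of non-causal Wiener separation, which requires that the Wiener estimates of $y_J$ from $y_I\cup y_Z$ and from $y_Z$ alone be identical.
   Formalization: The network is also assumed causally stable: I − Q(z) is invertible on the unit circle with a stable causal inverse. Without this the claim fails, e.g. y1=y2, y2=y1 with zero noise, y3=u3, and solution y1=y2=u3. *)

theory Defs
  imports "HOL-Probability.Probability" "HOL-Computational_Algebra.Polynomial"
begin

section \<open>Transfer functions\<close>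

text \<open>A transfer function in \<open>F\<close> is identified with the bi-infinite sequence \<open>p\<close> of its
  coefficients, $P(z) = \sum_k p_k z^{-k}$ on the unit circle, by which it is uniquely determined.
  Membership requires the sum to be a real-rational function \<open>N / D\<close> that has no pole on the circle
  and is either zero or without zeros there (invertible).\<close>

type_synonym tf = "int \<Rightarrow> real"

definition zeval :: "tf \<Rightarrow> complex \<Rightarrow> complex" where
  "zeval p z = (\<Sum>\<^sub>\<infinity>k. of_real (p k) * z powi (- k))"

definition tf_set :: "tf set" where
  "tf_set = {p. \<exists>N D :: real poly.
     (\<forall>z::complex. norm z = 1 \<longrightarrow> poly (map_poly of_real D) z \<noteq> 0) \<and>
     (N = 0 \<or> (\<forall>z::complex. norm z = 1 \<longrightarrow> poly (map_poly of_real N) z \<noteq> 0)) \<and>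
     (\<forall>z::complex. norm z = 1 \<longrightarrow>
        ((\<lambda>k. of_real (p k) * z powi (- k)) has_sum
           (poly (map_poly of_real N) z / poly (map_poly of_real D) z)) UNIV)}"

definition causal :: "tf \<Rightarrow> bool" where
  "causal p \<longleftrightarrow> (\<forall>k<0. p k = 0)"

definition causal_tf_set :: "tf set" where
  "causal_tf_set = {p \<in> tf_set. causal p}"

section \<open>Processes\<close>

text \<open>A real scalar process is a function of time and outcome; a vector process has a further
  (component) argument in front.\<close>

type_synonym 'w process = "int \<Rightarrow> 'w \<Rightarrow> real"

definition tf_apply :: "tf \<Rightarrow> 'w process \<Rightarrow> 'w process" where
  "tf_apply p x = (\<lambda>t \<omega>. \<Sum>\<^sub>\<infinity>k. p (t - k) * x k \<omega>)"

definition wide_sense_stationary :: "'w measure \<Rightarrow> ('c \<Rightarrow> 'w process) \<Rightarrow> bool" where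
  "wide_sense_stationary M x \<longleftrightarrow>
     (\<forall>a t. x a t \<in> borel_measurable M \<and> integrable M (\<lambda>\<omega>. (x a t \<omega>)\<^sup>2)) \<and>
     (\<forall>a t. (\<integral>\<omega>. x a t \<omega> \<partial>M) = (\<integral>\<omega>. x a 0 \<omega> \<partial>M)) \<and>
     (\<forall>a b s t. (\<integral>\<omega>. x a (t + s) \<omega> * x b t \<omega> \<partial>M) = (\<integral>\<omega>. x a s \<omega> * x b 0 \<omega> \<partial>M))"

text \<open>The spectral density is the transform of the correlation sequence (means not subtracted).
  It is a relation, because \<open>infsum\<close> would silently be zero for a divergent sum.\<close>

definition has_psd :: "'w measure \<Rightarrow> ('c \<Rightarrow> 'w process) \<Rightarrow> (complex \<Rightarrow> complex ^ 'c ^ 'c) \<Rightarrow> bool" where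
  "has_psd M x \<Phi> \<longleftrightarrow> (\<forall>z a b. norm z = 1 \<longrightarrow>
     ((\<lambda>s. of_real (\<integral>\<omega>. x a s \<omega> * x b 0 \<omega> \<partial>M) * z powi (- s)) has_sum (\<Phi> z $ a $ b)) UNIV)"

definition psd_pos_def_on :: "'c set \<Rightarrow> (complex \<Rightarrow> complex ^ 'c ^ 'c) \<Rightarrow> bool" where
  "psd_pos_def_on S \<Phi> \<longleftrightarrow> (\<forall>z (v :: complex ^ 'c). norm z = 1 \<longrightarrow> v \<noteq> 0 \<longrightarrow>
     (\<forall>a. a \<notin> S \<longrightarrow> v $ a = 0) \<longrightarrow> 0 < Re (\<Sum>a\<in>S. \<Sum>b\<in>S. cnj (v $ a) * \<Phi> z $ a $ b * v $ b))"

section \<open>Linear dynamic influence models\<close>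

text \<open>The nodes form the finite type \<open>'v\<close>. Nodes may be vector valued: \<open>'c\<close> indexes the scalar
  components of the stacked output \<open>y\<close> and \<open>\<nu> a\<close> is the node to which component \<open>a\<close> belongs; likewise
  \<open>'d\<close> and \<open>\<mu>\<close> for the stacked input \<open>u\<close>. Block \<open>(j, i)\<close> of \<open>Q\<close> consists of the entries \<open>Q a b\<close> with
  \<open>\<nu> a = j\<close> and \<open>\<nu> b = i\<close>.\<close>

definition ldim ::
  "'w measure \<Rightarrow> ('c::finite \<Rightarrow> 'v::finite) \<Rightarrow> ('d::finite \<Rightarrow> 'v) \<Rightarrow> ('c \<Rightarrow> 'c \<Rightarrow> tf) \<Rightarrow> ('c \<Rightarrow> 'd \<Rightarrow> tf) \<Rightarrow>
   ('d \<Rightarrow> 'w process) \<Rightarrow> ('c \<Rightarrow> 'w process) \<Rightarrow> ('c \<Rightarrow> 'w process) \<Rightarrow> bool" where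
  "ldim M \<nu> \<mu> Q P u e y \<longleftrightarrow>
     prob_space M \<and>
     (\<forall>a b. Q a b \<in> tf_set) \<and>
     (\<forall>a c. P a c \<in> causal_tf_set) \<and>
     (\<forall>a c. \<nu> a \<noteq> \<mu> c \<longrightarrow> P a c = (\<lambda>_. 0)) \<and>
     wide_sense_stationary M u \<and> has_psd M u (\<lambda>_. mat 1) \<and>
     wide_sense_stationary M y \<and>
     (\<forall>a t. AE \<omega> in M. e a t \<omega> = (\<Sum>c\<in>UNIV. tf_apply (P a c) (u c) t \<omega>)) \<and>
     (\<forall>a t. AE \<omega> in M. y a t \<omega> = (\<Sum>b\<in>UNIV. tf_apply (Q a b) (y b) t \<omega>) + e a t \<omega>)"

definition causal_ldim :: "('c \<Rightarrow> 'c \<Rightarrow> tf) \<Rightarrow> bool" where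
  "causal_ldim Q \<longleftrightarrow> (\<forall>a b. causal (Q a b))"

definition zeval_matrix :: "('c \<Rightarrow> 'c \<Rightarrow> tf) \<Rightarrow> complex \<Rightarrow> complex ^ 'c ^ 'c" where
  "zeval_matrix Q z = (\<chi> a b. zeval (Q a b) z)"

text \<open>Stability of the interconnection \<open>y = Q y + e\<close> as a causal system: \<open>I - Q\<close> is invertible on the
  unit circle and the entries of its inverse are stable (absolutely summable) and causal.
  Entries in \<^const>\<open>tf_set\<close> with every entry of \<open>Q\<close> causal do not guarantee this: \<open>1 - 2 z\<^sup>-\<^sup>1\<close> is
  invertible on the circle, but its inverse there is not causal.\<close>

definition causally_stable :: "('c::finite \<Rightarrow> 'c \<Rightarrow> tf) \<Rightarrow> bool" where
  "causally_stable Q \<longleftrightarrow> (\<exists>H :: 'c \<Rightarrow> 'c \<Rightarrow> tf.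
     (\<forall>a b. causal (H a b) \<and> (\<lambda>k. \<bar>H a b k\<bar>) summable_on UNIV) \<and>
     (\<forall>z. norm z = 1 \<longrightarrow> (mat 1 - zeval_matrix Q z) ** zeval_matrix H z = mat 1))"

definition graphical_representation ::
  "('v \<times> 'v) set \<Rightarrow> ('c \<Rightarrow> 'v) \<Rightarrow> ('c \<Rightarrow> 'c \<Rightarrow> tf) \<Rightarrow> bool" where
  "graphical_representation E \<nu> Q \<longleftrightarrow>
     (\<forall>i j. (i, j) \<notin> E \<longrightarrow> (\<forall>a b. \<nu> a = j \<longrightarrow> \<nu> b = i \<longrightarrow> Q a b = (\<lambda>_. 0)))"

section \<open>d-separation\<close>

text \<open>The graph may contain both \<open>(i, j)\<close> and \<open>(j, i)\<close>, so that the visited nodes do not determine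
  which edges a path uses, and hence its colliders. A path is therefore a node list \<open>p\<close> together with
  a list \<open>d\<close> of orientations: \<open>d ! k\<close> holds if step \<open>k\<close> uses an edge from \<open>p ! k\<close> to \<open>p ! Suc k\<close>,
  and fails if it uses an edge in the opposite direction.\<close>

definition is_path :: "('v \<times> 'v) set \<Rightarrow> 'v list \<Rightarrow> bool list \<Rightarrow> bool" where
  "is_path E p d \<longleftrightarrow> d \<noteq> [] \<and> length p = Suc (length d) \<and> distinct (zip p (tl p)) \<and>
     (\<forall>k<length d. if d ! k then (p ! k, p ! Suc k) \<in> E else (p ! Suc k, p ! k) \<in> E)"

definition collider :: "bool list \<Rightarrow> nat \<Rightarrow> bool" where
  "collider d k \<longleftrightarrow> 0 < k \<and> k < length d \<and> d ! (k - 1) \<and> \<not> d ! k"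

definition descendants :: "('v \<times> 'v) set \<Rightarrow> 'v \<Rightarrow> 'v set" where
  "descendants E v = E\<^sup>* `` {v}"

definition blocked :: "('v \<times> 'v) set \<Rightarrow> 'v set \<Rightarrow> 'v list \<Rightarrow> bool list \<Rightarrow> bool" where
  "blocked E Z p d \<longleftrightarrow>
     (\<exists>k<length p. p ! k \<in> Z \<and> \<not> collider d k) \<or>
     (\<exists>k<length p. collider d k \<and> descendants E (p ! k) \<inter> Z = {})"

definition dsep :: "('v \<times> 'v) set \<Rightarrow> 'v set \<Rightarrow> 'v set \<Rightarrow> 'v set \<Rightarrow> bool" where
  "dsep E I Z J \<longleftrightarrow>
     (\<forall>p d. is_path E p d \<longrightarrow> hd p \<in> I \<longrightarrow> last p \<in> J \<longrightarrow> blocked E Z p d)"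

section \<open>Causal Wiener filtering and separation\<close>

definition ctfspan :: "'c set \<Rightarrow> ('c \<Rightarrow> 'w process) \<Rightarrow> 'w process set" where
  "ctfspan S y = {\<lambda>t \<omega>. \<Sum>s\<in>S. tf_apply (P s) (y s) t \<omega> | P. \<forall>s\<in>S. P s \<in> causal_tf_set}"

definition mse :: "'w measure \<Rightarrow> 'a set \<Rightarrow> ('a \<Rightarrow> 'w process) \<Rightarrow> ('a \<Rightarrow> 'w process) \<Rightarrow> int \<Rightarrow> real" where
  "mse M A x q t = (\<integral>\<omega>. (\<Sum>a\<in>A. (x a t \<omega> - q a t \<omega>)\<^sup>2) \<partial>M)"

definition causal_wiener_estimate ::
  "'w measure \<Rightarrow> 'a set \<Rightarrow> ('a \<Rightarrow> 'w process) \<Rightarrow> 'c set \<Rightarrow> ('c \<Rightarrow> 'w process) \<Rightarrow> ('a \<Rightarrow> 'w process) \<Rightarrow> bool"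
where
  "causal_wiener_estimate M A x S y q \<longleftrightarrow>
     (\<forall>a\<in>A. q a \<in> ctfspan S y) \<and>
     (\<forall>r. (\<forall>a\<in>A. r a \<in> ctfspan S y) \<longrightarrow> (\<forall>t. mse M A x q t \<le> mse M A x r t))"

definition causal_wiener_filter ::
  "'w measure \<Rightarrow> 'a set \<Rightarrow> ('a \<Rightarrow> 'w process) \<Rightarrow> 'c set \<Rightarrow> ('c \<Rightarrow> 'w process) \<Rightarrow> ('a \<Rightarrow> 'c \<Rightarrow> tf) \<Rightarrow> bool"
where
  "causal_wiener_filter M A x S y W \<longleftrightarrow>
     (\<forall>a\<in>A. \<forall>s\<in>S. W a s \<in> causal_tf_set) \<and>
     causal_wiener_estimate M A x S y (\<lambda>a t \<omega>. \<Sum>s\<in>S. tf_apply (W a s) (y s) t \<omega>)"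

text \<open>The first clause says that the component of the filter associated with \<open>y\<^sub>I\<close> vanishes; it applies
  when the density of the observed processes is positive definite, which makes the filter unique. When
  the density is singular, one and the same estimate can arise from several filters, and the minimum
  over \<^const>\<open>ctfspan\<close> need not be attained. The second clause covers these cases: it says that the
  estimates of \<open>y\<^sub>J\<close> from \<open>y\<^sub>I, y\<^sub>Z\<close> and from \<open>y\<^sub>Z\<close> alone have the same optimal error, i.e. agree
  in the mean-square closure of \<^const>\<open>ctfspan\<close>.\<close>

definition cwsep ::
  "'w measure \<Rightarrow> ('c::finite \<Rightarrow> 'v) \<Rightarrow> ('c \<Rightarrow> 'w process) \<Rightarrow> 'v set \<Rightarrow> 'v set \<Rightarrow> 'v set \<Rightarrow> bool" where
  "cwsep M \<nu> y I Z J \<longleftrightarrow>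
     (\<forall>\<Phi> W. has_psd M y \<Phi> \<longrightarrow> psd_pos_def_on (\<nu> -` (I \<union> Z)) \<Phi> \<longrightarrow>
        causal_wiener_filter M (\<nu> -` J) y (\<nu> -` (I \<union> Z)) y W \<longrightarrow>
        (\<forall>a\<in>\<nu> -` J. \<forall>b\<in>\<nu> -` I. W a b = (\<lambda>_. 0))) \<and>
     (\<forall>q \<epsilon>. (\<forall>a\<in>\<nu> -` J. q a \<in> ctfspan (\<nu> -` (I \<union> Z)) y) \<longrightarrow> 0 < \<epsilon> \<longrightarrow>
        (\<exists>r. (\<forall>a\<in>\<nu> -` J. r a \<in> ctfspan (\<nu> -` Z) y) \<and>
             (\<forall>t. mse M (\<nu> -` J) y r t \<le> mse M (\<nu> -` J) y q t + \<epsilon>)))"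

end

(* Restrict the network to the ancestors A of I \<union> Z \<union> J and put T = 1 - Q. By d-separation, A minus Z
   splits into I' \<supseteq> I and J' \<supseteq> J, and the equations in A split into U and V, such that those in U only
   involve I' \<union> Z and those in V only J' \<union> Z. Let G be the causal inverse of T on A. Then y = G e is the
   sum of the orthogonal parts yU and yV that are driven by the innovations in U and in V.
   As T has no entries in U x J' and V x I', the identity G T = 1 shows that yU is a causal filter of
   y_Z on J' \<union> Z, and yV is one on I' \<union> Z. No invertibility of T on I' or J' is needed.
   An estimate q of y_J from y_I and y_Z splits into qU + qV, where qV is a filter of y_Z. Replacing
   qU by yU gives an estimate r from y_Z alone, and E(y - q)^2 = E(y - r)^2 + E(q - r)^2. Hence y_Z is
   as good as y_I and y_Z together, and an optimal q equals r; if the density is positive definite,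
   then q = r forces the filters to agree. *)
theory Submission
  imports Defs
begin

section \<open>Summable sequences and their transforms\<close>

text \<open>The set \<open>tf_set\<close> is not closed under sums, because a sum may acquire zeros
  on the unit circle. The argument therefore runs in absolutely summable causal sequences, and a
  rational filter replaces the result only at the end, at the cost of an \<epsilon>; the equality of
  an optimal q with r comes from a bound that holds for every \<epsilon>. Causality of the network
  enters through the products of entries of G and T: they are causal, so the filters that express yU
  and yV through y_Z use only the past. Passing to the ancestors keeps the inverse: A is closed
  under parents, so T is block triangular, and the block of its global inverse on A inverts the
  block of T. In the splitting of the equations the nodes of Z are the delicate ones: one with a
  parent in I' and another in J' would be an open collider, through which the second parent is
  reachable as well. Since \<open>dsep\<close> speaks of paths and I' is defined by reachability,
  walks must be shortened to paths. Processes are pointwise sums with value 0 where they diverge, so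
  identities between them hold only almost surely.\<close>

definition conv :: "(int \<Rightarrow> 'a::{real_normed_field,banach}) \<Rightarrow> (int \<Rightarrow> 'a) \<Rightarrow> int \<Rightarrow> 'a" where
  "conv p q n = (\<Sum>\<^sub>\<infinity>k. p (n - k) * q k)"

lemma tf_apply_conv: "tf_apply p x t \<omega> = conv p (\<lambda>k. x k \<omega>) t"
  by (simp add: tf_apply_def conv_def)

text \<open>Unordered convergence of real sums is absolute, so \<open>p summable_on UNIV\<close>
  expresses the stability of the filter \<open>p\<close> in everything that follows.\<close>

lemma summable_on_abs_iff [simp]:
  fixes f :: "'b \<Rightarrow> real"
  shows "(\<lambda>x. \<bar>f x\<bar>) summable_on A \<longleftrightarrow> f summable_on A"
  using summable_on_iff_abs_summable_on_real[of f A] by simp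

lemma summable_on_int_shift:
  fixes f :: "int \<Rightarrow> 'a::{real_normed_field,banach}"
  shows "(\<lambda>k. f (n - k)) summable_on UNIV \<longleftrightarrow> f summable_on UNIV"
    and "(\<lambda>k. f (k - n)) summable_on UNIV \<longleftrightarrow> f summable_on UNIV"
  by (rule summable_on_reindex_bij_witness[of _ "\<lambda>k. n - k" "\<lambda>k. n - k"]; simp)
     (rule summable_on_reindex_bij_witness[of _ "\<lambda>k. k + n" "\<lambda>k. k - n"]; simp)

lemma infsum_int_shift:
  fixes f :: "int \<Rightarrow> 'a::{real_normed_field,banach}"
  shows "(\<Sum>\<^sub>\<infinity>k. f (n - k)) = infsum f UNIV" "(\<Sum>\<^sub>\<infinity>k. f (k - n)) = infsum f UNIV"
  by (rule infsum_reindex_bij_witness[of _ "\<lambda>k. n - k" "\<lambda>k. n - k"]; simp)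
     (rule infsum_reindex_bij_witness[of _ "\<lambda>k. k + n" "\<lambda>k. k - n"]; simp)

lemma abs_summable_conv_double:
  fixes p q :: "int \<Rightarrow> 'a::{real_normed_field,banach}"
  assumes "(\<lambda>k. norm (p k)) summable_on UNIV" "(\<lambda>k. norm (q k)) summable_on UNIV"
  shows "(\<lambda>x. norm (case x of (k, n) \<Rightarrow> p (n - k) * q k)) summable_on UNIV \<times> UNIV"
proof -
  have "(\<lambda>n. norm (p (n - k) * q k)) summable_on UNIV" for k
    using assms(1) summable_on_int_shift(2)[of "\<lambda>k. norm (p k)" k]
    by (auto simp: norm_mult intro!: summable_on_cmult_left)
  moreover have "(\<lambda>k. norm (\<Sum>\<^sub>\<infinity>n. norm (p (n - k) * q k))) summable_on UNIV"
    using assms(2) infsum_int_shift(2)[of "\<lambda>k. norm (p k)"]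
    by (simp add: norm_mult infsum_cmult_left' abs_mult summable_on_cmult_right)
  ultimately show ?thesis
    by (subst Infinite_Sum.abs_summable_on_Sigma_iff) auto
qed

text \<open>Fubini for the double family: when \<open>n\<close> is summed first, the shift by
  \<open>k\<close> drops out and the sums factor.\<close>

lemma conv_sums:
  fixes p q :: "int \<Rightarrow> 'a::{real_normed_field,banach}"
  assumes "(\<lambda>k. norm (p k)) summable_on UNIV" "(\<lambda>k. norm (q k)) summable_on UNIV"
  shows "conv p q summable_on UNIV" "infsum (conv p q) UNIV = infsum p UNIV * infsum q UNIV"
proof -
  have s: "(\<lambda>(k, n). p (n - k) * q k) summable_on UNIV \<times> UNIV"
    using abs_summable_conv_double[OF assms] by (rule abs_summable_summable)
  then have s': "(\<lambda>(n, k). p (n - k) * q k) summable_on UNIV \<times> UNIV"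
    by (subst (asm) summable_on_swap) (simp add: case_prod_unfold)
  show "conv p q summable_on UNIV"
    using summable_on_Sigma_banach[of "\<lambda>n k. p (n - k) * q k" UNIV "\<lambda>_. UNIV"] s'
    by (simp add: conv_def[abs_def])
  have "infsum (conv p q) UNIV = (\<Sum>\<^sub>\<infinity>k. \<Sum>\<^sub>\<infinity>n. p (n - k) * q k)"
    using infsum_swap_banach[OF s] by (simp add: conv_def[abs_def])
  also have "\<dots> = infsum p UNIV * infsum q UNIV"
    by (simp add: infsum_cmult_left' infsum_cmult_right' infsum_int_shift)
  finally show "infsum (conv p q) UNIV = infsum p UNIV * infsum q UNIV" .
qed

lemma summable_conv_terms:
  fixes p q :: "int \<Rightarrow> 'a::{real_normed_field,banach}"
  assumes "(\<lambda>k. norm (p k)) summable_on UNIV" "(\<lambda>k. norm (q k)) summable_on UNIV"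
  shows "(\<lambda>k. norm (p (n - k) * q k)) summable_on UNIV"
proof (rule Infinite_Sum.abs_summable_on_comparison_test)
  let ?C = "\<Sum>\<^sub>\<infinity>k. norm (p k)"
  have C: "norm (p m) \<le> ?C" for m
    using infsum_mono2[of "\<lambda>k. norm (p k)" "{m}" UNIV] assms(1) by simp
  show "(\<lambda>k. norm (of_real ?C * q k)) summable_on UNIV"
    using assms(2) by (simp add: norm_mult summable_on_cmult_right)
  show "norm (p (n - k) * q k) \<le> norm (of_real ?C * q k)" for k
    using C[of "n - k"] by (auto simp: norm_mult intro!: mult_right_mono)
qed

lemma summable_conv:
  fixes p q :: "int \<Rightarrow> real"
  assumes "p summable_on UNIV" "q summable_on UNIV"
  shows "conv p q summable_on UNIV"
  using conv_sums[of p q] assms by simp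

lemma causal_conv:
  assumes "causal p" "causal q"
  shows "causal (conv p q)"
  unfolding causal_def conv_def
proof (intro allI impI)
  fix n :: int assume "n < 0"
  then have "p (n - k) * q k = 0" for k
    using assms by (cases "k < 0") (auto simp: causal_def)
  then show "(\<Sum>\<^sub>\<infinity>k. p (n - k) * q k) = 0" by (intro infsum_0)
qed

text \<open>Here \<open>x\<close> may be unbounded, so that the hypothesis is not implied by the summability of \<open>p\<close> and \<open>q\<close>.\<close>

lemma conv_conv:
  fixes p q x :: "int \<Rightarrow> real"
  assumes p: "p summable_on UNIV" and q: "q summable_on UNIV"
    and x: "(\<lambda>m. conv (\<lambda>k. \<bar>p k\<bar>) (\<lambda>k. \<bar>q k\<bar>) (t - m) * \<bar>x m\<bar>) summable_on UNIV"
  shows "conv p (conv q x) t = conv (conv p q) x t"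
proof -
  have pq: "(\<lambda>k. norm (p k)) summable_on UNIV" "(\<lambda>k. norm (q k)) summable_on UNIV"
    using p q by simp_all
  have shift: "(\<Sum>\<^sub>\<infinity>k. f (t - k) * g (k - m)) = conv f g (t - m)" for f g :: "int \<Rightarrow> real" and m
    unfolding conv_def
    by (rule infsum_reindex_bij_witness[of _ "\<lambda>k. k + m" "\<lambda>k. k - m"]) auto
  have shift': "(\<lambda>k. norm (p (t - k) * q (k - m))) summable_on UNIV" for m
  proof -
    have "(\<lambda>k. norm (p (t - k) * q (k - m))) summable_on UNIV
        \<longleftrightarrow> (\<lambda>k. norm (p (t - m - k) * q k)) summable_on UNIV"
      by (rule summable_on_reindex_bij_witness[of _ "\<lambda>k. k + m" "\<lambda>k. k - m"]) auto
    then show ?thesis using summable_conv_terms[OF pq, of "t - m"] by blast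
  qed
  \<comment> \<open>Summed over \<open>k\<close> first, the absolute values give exactly the family
    that the hypothesis makes summable, which permits the exchange of the sums.\<close>
  have inner: "(\<Sum>\<^sub>\<infinity>k. norm (p (t - k) * q (k - m) * x m))
      = conv (\<lambda>k. \<bar>p k\<bar>) (\<lambda>k. \<bar>q k\<bar>) (t - m) * \<bar>x m\<bar>" for m
    by (simp only: real_norm_def abs_mult infsum_cmult_left' shift[of "\<lambda>k. \<bar>p k\<bar>" "\<lambda>k. \<bar>q k\<bar>"])
  have "(\<lambda>y. norm (case y of (m, k) \<Rightarrow> p (t - k) * q (k - m) * x m)) summable_on UNIV \<times> UNIV"
  proof (subst Infinite_Sum.abs_summable_on_Sigma_iff, intro conjI ballI)
    fix m
    show "(\<lambda>k. norm (case (m, k) of (m, k) \<Rightarrow> p (t - k) * q (k - m) * x m)) summable_on UNIV"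
      using summable_on_cmult_left[OF shift'[of m], of "\<bar>x m\<bar>"] by (simp add: abs_mult)
    show "(\<lambda>m. norm (\<Sum>\<^sub>\<infinity>k. norm (case (m, k) of (m, k) \<Rightarrow> p (t - k) * q (k - m) * x m))) summable_on UNIV"
      using x unfolding prod.case inner by (simp only: real_norm_def summable_on_abs_iff)
  qed
  then have "(\<lambda>(m, k). p (t - k) * q (k - m) * x m) summable_on UNIV \<times> UNIV"
    by (rule abs_summable_summable)
  note swap = infsum_swap_banach[OF this]
  have "(\<Sum>\<^sub>\<infinity>m. (\<Sum>\<^sub>\<infinity>k. p (t - k) * q (k - m)) * x m) = (\<Sum>\<^sub>\<infinity>m. \<Sum>\<^sub>\<infinity>k. p (t - k) * q (k - m) * x m)"
    by (simp only: infsum_cmult_left')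
  also note swap
  also have "(\<Sum>\<^sub>\<infinity>k. \<Sum>\<^sub>\<infinity>m. p (t - k) * q (k - m) * x m) = (\<Sum>\<^sub>\<infinity>k. p (t - k) * (\<Sum>\<^sub>\<infinity>m. q (k - m) * x m))"
    by (simp only: mult.assoc infsum_cmult_right')
  finally show ?thesis
    unfolding shift[of p q] by (simp only: conv_def[of p "conv q x"] conv_def[of "conv p q" x] conv_def[of q x])
qed

section \<open>The transform on the unit circle and the uniqueness of its coefficients\<close>

lemma norm_powi_unit: "norm z = 1 \<Longrightarrow> norm (z powi k :: complex) = 1"
  by (simp add: norm_power_int)

lemma zeval_abs_summable:
  fixes z :: complex
  assumes "p summable_on UNIV" "norm z = 1"
  shows "(\<lambda>k. norm (of_real (p k) * z powi (- k))) summable_on UNIV"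
  using assms by (simp add: norm_mult norm_powi_unit)

lemma zeval_has_sum:
  assumes "p summable_on UNIV" "norm z = 1"
  shows "((\<lambda>k. of_real (p k) * z powi (- k)) has_sum zeval p z) UNIV"
  unfolding zeval_def
  using has_sum_infsum[OF abs_summable_summable[OF zeval_abs_summable[OF assms]]] .

lemma infsum_of_real:
  fixes f :: "'b \<Rightarrow> real"
  assumes "f summable_on A"
  shows "(of_real (infsum f A) :: 'a::real_normed_field) = (\<Sum>\<^sub>\<infinity>x\<in>A. of_real (f x))"
  using has_sum_of_real[OF has_sum_infsum[OF assms]] by (metis infsumI)

text \<open>Since z^(-n) = z^(-(n-k)) z^(-k), weighting the coefficients commutes with convolution,
  and \<open>conv_sums\<close> applies to the weighted sequences. These are complex, hence the
  generality of \<open>conv\<close>.\<close>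

lemma zeval_conv:
  assumes p: "p summable_on UNIV" and q: "q summable_on UNIV" and z: "norm z = 1"
  shows "zeval (conv p q) z = zeval p z * zeval q z"
proof -
  have "z \<noteq> 0" using z by auto
  have "of_real (conv p q n) * z powi (- n)
      = conv (\<lambda>k. of_real (p k) * z powi (- k)) (\<lambda>k. of_real (q k) * z powi (- k)) n" for n
  proof -
    have "(\<lambda>k. p (n - k) * q k) summable_on UNIV"
      using summable_conv_terms[of p q n] p q by simp
    then have "of_real (conv p q n) * z powi (- n) = (\<Sum>\<^sub>\<infinity>k. of_real (p (n - k) * q k) * z powi (- n))"
      by (simp only: conv_def infsum_of_real infsum_cmult_left')
    moreover have "of_real (p (n - k) * q k) * z powi (- n)
        = (of_real (p (n - k)) * z powi (- (n - k))) * (of_real (q k) * z powi (- k))" for k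
    proof -
      have "z powi (- n) = z powi (- (n - k)) * z powi (- k)"
        using power_int_add[of z "- (n - k)" "- k"] \<open>z \<noteq> 0\<close> by simp
      then show ?thesis by (simp only: of_real_mult mult_ac)
    qed
    ultimately show ?thesis by (simp only: conv_def)
  qed
  then show ?thesis
    using conv_sums(2)[OF zeval_abs_summable[OF p z] zeval_abs_summable[OF q z]]
    by (simp add: zeval_def)
qed

lemma zeval_add:
  assumes "p summable_on UNIV" "q summable_on UNIV" "norm z = 1"
  shows "zeval (\<lambda>k. p k + q k) z = zeval p z + zeval q z"
  using has_sum_add[OF zeval_has_sum[OF assms(1,3)] zeval_has_sum[OF assms(2,3)]]
  unfolding zeval_def[of "\<lambda>k. p k + q k"] of_real_add distrib_right by (rule infsumI)

lemma summable_on_diff: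
  fixes f g :: "'b \<Rightarrow> real"
  assumes "f summable_on A" "g summable_on A"
  shows "(\<lambda>x. f x - g x) summable_on A"
  using summable_on_add[OF assms(1) summable_on_cmult_right[OF assms(2), of "- 1"]] by simp

lemma zeval_diff:
  assumes "p summable_on UNIV" "q summable_on UNIV" "norm z = 1"
  shows "zeval (\<lambda>k. p k - q k) z = zeval p z - zeval q z"
  using zeval_add[OF summable_on_diff[OF assms(1,2)] assms(2,3)] by simp

lemma zeval_zero [simp]: "zeval (\<lambda>_. 0) z = 0"
  by (simp add: zeval_def)

lemma summable_on_sum:
  fixes f :: "'b \<Rightarrow> 'a \<Rightarrow> real"
  assumes "\<And>i. i \<in> F \<Longrightarrow> f i summable_on A"
  shows "(\<lambda>x. \<Sum>i\<in>F. f i x) summable_on A"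
  using assms by (induction F rule: infinite_finite_induct) (auto intro: summable_on_add)

lemma zeval_sum:
  assumes "\<And>i. i \<in> F \<Longrightarrow> p i summable_on UNIV" "norm z = 1"
  shows "zeval (\<lambda>k. \<Sum>i\<in>F. p i k) z = (\<Sum>i\<in>F. zeval (p i) z)"
  using assms(1)
proof (induction F rule: infinite_finite_induct)
  case (insert i F)
  then have "(\<lambda>k. \<Sum>i\<in>F. p i k) summable_on UNIV" by (intro summable_on_sum) auto
  then show ?case
    using insert zeval_add[OF _ _ assms(2), of "p i" "\<lambda>k. \<Sum>i\<in>F. p i k"] by simp
qed simp_all

text \<open>A geometric sum whose ratio \<open>w\<close> is an N-th root of unity; the bounds on
  \<open>r\<close> exclude multiples of \<open>N\<close>, so that \<open>w\<close> differs from
  1.\<close>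

lemma sum_cis_multiples:
  fixes r :: int
  assumes "N > 0" "\<bar>r\<bar> < int N" "r \<noteq> 0"
  shows "(\<Sum>m<N. cis (2 * pi * real m / N) powi r) = 0"
proof -
  define w where "w = cis (2 * pi * r / N)"
  have "w \<noteq> 1"
  proof
    assume "w = 1"
    then obtain k :: int where "2 * pi * r / N = 2 * pi * of_int k"
      by (auto simp: w_def complex_eq_iff cos_one_2pi_int)
    then have "real_of_int r = of_int (k * int N)"
      using assms by (simp add: field_simps)
    then have "r = k * int N" by linarith
    then show False using assms by (cases "k = 0") (auto simp: abs_mult)
  qed
  moreover have "w ^ N = 1"
  proof -
    have "w ^ N = cis (real N * (2 * pi * r / N))" by (simp only: w_def Complex.DeMoivre)
    also have "real N * (2 * pi * r / N) = 2 * pi * r" using assms by simp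
    finally have "w ^ N = cis (2 * pi * r)" .
    then show ?thesis by simp
  qed
  moreover have "(\<Sum>m<N. cis (2 * pi * real m / N) powi r) = (\<Sum>m<N. w ^ m)"
    by (intro sum.cong refl) (simp add: w_def Complex.DeMoivre cis_power_int mult_ac)
  ultimately show ?thesis
    by (simp add: geometric_sum)
qed

text \<open>Allowing every finite superset of \<open>F\<close> lets the applications add indices of
  their own: the coefficient to be isolated, or an initial segment of the natural numbers.\<close>

lemma summable_tail:
  fixes p :: "'b \<Rightarrow> real"
  assumes "p summable_on UNIV" "\<epsilon> > 0"
  obtains F where "finite F"
    "\<And>G. finite G \<Longrightarrow> F \<subseteq> G \<Longrightarrow> (\<Sum>\<^sub>\<infinity>k\<in>-G. \<bar>p k\<bar>) \<le> \<epsilon>"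
proof -
  let ?a = "\<lambda>k. \<bar>p k\<bar>"
  have a: "?a summable_on UNIV" using assms by simp
  obtain F where F: "finite F" "dist (sum ?a F) (infsum ?a UNIV) \<le> \<epsilon>"
    using infsum_finite_approximation[OF a assms(2)] by auto
  have "infsum ?a (- G) \<le> \<epsilon>" if G: "finite G" "F \<subseteq> G" for G
  proof -
    have "sum ?a F \<le> sum ?a G" using G by (intro sum_mono2) auto
    moreover have "infsum ?a UNIV = sum ?a G + infsum ?a (- G)"
      using infsum_Un_disjoint[of ?a G "- G"] summable_on_subset_banach[OF a subset_UNIV, of "- G"] G(1)
      by simp
    ultimately show ?thesis
      using F(2) unfolding dist_real_def by linarith
  qed
  with F(1) show thesis by (rule that)
qed

text \<open>Averaging \<open>zeval p z * z\<^sup>j\<close> over the \<open>N\<close>-th roots of unity leaves the sum of the \<open>p k\<close> with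
  \<open>k \<equiv> j (mod N)\<close>, which tends to \<open>p j\<close> as \<open>N\<close> grows.\<close>

lemma zeval_eq_zero_imp:
  assumes p: "p summable_on UNIV" and zero: "\<And>z. norm z = 1 \<Longrightarrow> zeval p z = 0"
  shows "p = (\<lambda>_. 0)"
proof
  fix j
  have "\<bar>p j\<bar> \<le> \<epsilon>" if \<epsilon>: "\<epsilon> > 0" for \<epsilon>
  proof -
    obtain F0 where F0: "finite F0" "\<And>G. finite G \<Longrightarrow> F0 \<subseteq> G \<Longrightarrow> (\<Sum>\<^sub>\<infinity>k\<in>-G. \<bar>p k\<bar>) \<le> \<epsilon>"
      using summable_tail[OF p \<epsilon>] by blast
    define F where "F = insert j F0"
    have F: "finite F" "j \<in> F" using F0 by (auto simp: F_def)
    have rest: "(\<Sum>\<^sub>\<infinity>k\<in>-F. \<bar>p k\<bar>) \<le> \<epsilon>"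
      using F0(2)[of F] F by (auto simp: F_def)
    \<comment> \<open>\<open>N\<close> exceeds the distance from \<open>j\<close> to every index in
      \<open>F\<close>, so that \<open>j\<close> is the only index of \<open>F\<close> in its
      residue class modulo \<open>N\<close>.\<close>
    obtain N where N0: "N > 0" and N: "\<And>k. k \<in> F \<Longrightarrow> \<bar>j - k\<bar> < int N"
    proof
      show "Suc (\<Sum>k\<in>F. nat \<bar>j - k\<bar>) > 0" by simp
      fix k assume "k \<in> F"
      then have "nat \<bar>j - k\<bar> < Suc (\<Sum>k\<in>F. nat \<bar>j - k\<bar>)"
        using member_le_sum[of k F "\<lambda>k. nat \<bar>j - k\<bar>"] F by (simp add: less_Suc_eq_le)
      then show "\<bar>j - k\<bar> < int (Suc (\<Sum>k\<in>F. nat \<bar>j - k\<bar>))" by linarith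
    qed
    define \<zeta> where "\<zeta> m = cis (2 * pi * real m / real N)" for m
    have avg: "(\<Sum>m<N. \<zeta> m powi r) = (if r = 0 then of_nat N else 0)" if "\<bar>r\<bar> < int N" for r
      using sum_cis_multiples[of N r] that N0 by (auto simp: \<zeta>_def)
    have nz: "norm (\<zeta> m) = 1" "\<zeta> m \<noteq> 0" for m by (simp_all add: \<zeta>_def)
    define R where "R m = (\<Sum>\<^sub>\<infinity>k\<in>-F. of_real (p k) * \<zeta> m powi (- k))" for m
    have R: "norm (R m) \<le> \<epsilon>" for m
    proof -
      have "(\<lambda>k. norm (of_real (p k) * \<zeta> m powi (- k))) summable_on (- F)"
        using zeval_abs_summable[OF p nz(1)] by (rule summable_on_subset_banach) simp
      then have "norm (R m) \<le> (\<Sum>\<^sub>\<infinity>k\<in>-F. norm (of_real (p k) * \<zeta> m powi (- k)))"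
        unfolding R_def by (rule norm_infsum_bound)
      then show ?thesis using rest by (simp add: norm_mult norm_powi_unit nz)
    qed
    have split: "(\<Sum>k\<in>F. of_real (p k) * \<zeta> m powi (- k)) = - R m" for m
    proof -
      have s: "(\<lambda>k. of_real (p k) * \<zeta> m powi (- k)) summable_on UNIV"
        using zeval_has_sum[OF p nz(1)] by (rule has_sum_imp_summable)
      have "zeval p (\<zeta> m) = (\<Sum>k\<in>F. of_real (p k) * \<zeta> m powi (- k)) + R m"
        unfolding zeval_def R_def
        using infsum_Un_disjoint[of "\<lambda>k. of_real (p k) * \<zeta> m powi (- k)" F "- F"]
          summable_on_subset_banach[OF s subset_UNIV, of "- F"] F(1) by simp
      then show ?thesis using zero[OF nz(1)] by (simp add: eq_neg_iff_add_eq_0)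
    qed
    \<comment> \<open>The average retains only \<open>k = j\<close> from \<open>F\<close>. As the
      whole transform vanishes, the sum over \<open>F\<close> is minus the tail \<open>R\<close>,
      whose norm is at most \<epsilon>.\<close>
    have "of_nat N * of_real (p j) = (\<Sum>k\<in>F. of_real (p k) * (\<Sum>m<N. \<zeta> m powi (j - k)))"
    proof -
      have "(\<Sum>k\<in>F. of_real (p k) * (\<Sum>m<N. \<zeta> m powi (j - k)))
          = (\<Sum>k\<in>F. if k = j then of_real (p k) * of_nat N else 0)"
      proof (intro sum.cong refl)
        fix k assume "k \<in> F"
        from avg[OF N[OF this]]
        show "of_real (p k) * (\<Sum>m<N. \<zeta> m powi (j - k)) = (if k = j then of_real (p k) * of_nat N else 0)"
          by (cases "k = j") simp_all
      qed
      then show ?thesis using F by simp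
    qed
    also have "\<dots> = (\<Sum>k\<in>F. \<Sum>m<N. \<zeta> m powi j * (of_real (p k) * \<zeta> m powi (- k)))"
      unfolding sum_distrib_left
    proof (intro sum.cong refl)
      fix k m
      have "\<zeta> m powi (j - k) = \<zeta> m powi j * \<zeta> m powi (- k)"
        using power_int_add[of "\<zeta> m" j "- k"] nz(2)[of m] by simp
      then show "of_real (p k) * \<zeta> m powi (j - k) = \<zeta> m powi j * (of_real (p k) * \<zeta> m powi (- k))"
        by (simp only: mult.left_commute)
    qed
    also have "\<dots> = (\<Sum>m<N. \<zeta> m powi j * - R m)"
      unfolding split[symmetric] sum_distrib_left by (rule sum.swap)
    finally have "norm (of_nat N * of_real (p j) :: complex) = norm (\<Sum>m<N. \<zeta> m powi j * - R m)"
      by (rule arg_cong)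
    also have "\<dots> \<le> (\<Sum>m<N. \<epsilon>)"
    proof (rule sum_norm_le)
      show "norm (\<zeta> m powi j * - R m) \<le> \<epsilon>" for m
        using R[of m] by (simp add: norm_mult norm_powi_unit nz(1))
    qed
    finally show ?thesis using N0 by (simp add: norm_mult)
  qed
  then have "\<bar>p j\<bar> \<le> 0"
    by (rule field_le_epsilon) simp
  then show "p j = 0" by simp
qed

lemma zeval_inject:
  assumes "p summable_on UNIV" "q summable_on UNIV" "\<And>z. norm z = 1 \<Longrightarrow> zeval p z = zeval q z"
  shows "p = q"
proof -
  have "(\<lambda>k. p k - q k) = (\<lambda>_. 0)"
    using assms by (intro zeval_eq_zero_imp) (auto simp: zeval_diff intro: summable_on_diff)
  then show ?thesis by (auto simp: fun_eq_iff)
qed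

text \<open>At z = 1 the transform is the plain sum of the coefficients, and its unordered
  convergence is absolute.\<close>

lemma tf_set_summable:
  assumes "p \<in> tf_set"
  shows "p summable_on UNIV"
proof -
  obtain N D :: "real poly" where "\<forall>z::complex. norm z = 1 \<longrightarrow> ((\<lambda>k. of_real (p k) * z powi (- k)) has_sum
      (poly (map_poly of_real N) z / poly (map_poly of_real D) z)) UNIV"
    using assms unfolding tf_set_def by blast
  from this[rule_format, of 1]
have "(\<lambda>k. of_real (p k) :: complex) summable_on UNIV"
    by (simp add: has_sum_imp_summable)
  then have "(\<lambda>k. norm (of_real (p k) :: complex)) summable_on UNIV"
    by (simp only: summable_on_iff_abs_summable_on_complex)
  then show ?thesis by simp
qed

definition delta :: "int \<Rightarrow> real" where "delta k = (if k = 0 then 1 else 0)"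

lemma summable_delta: "delta summable_on UNIV"
  by (rule finite_nonzero_values_imp_summable_on) (simp add: delta_def)

lemma causal_delta: "causal delta"
  by (simp add: causal_def delta_def)

lemma conv_delta: "conv delta x t = x t"
proof -
  have "conv delta x t = (\<Sum>\<^sub>\<infinity>k\<in>{t}. delta (t - k) * x k)"
    unfolding conv_def by (rule infsum_cong_neutral) (auto simp: delta_def)
  then show ?thesis by (simp add: delta_def)
qed

lemma zeval_delta: "zeval delta z = 1"
proof -
  have "zeval delta z = (\<Sum>\<^sub>\<infinity>k\<in>{0}. of_real (delta k) * z powi (- k))"
    unfolding zeval_def by (rule infsum_cong_neutral) (auto simp: delta_def)
  then show ?thesis by (simp add: delta_def)
qed

section \<open>Approximation of causal filters by rational ones\<close>

lemma map_poly_of_real_add: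
  "map_poly of_real (p + q) = (map_poly of_real p + map_poly of_real q :: complex poly)"
  by (rule poly_eqI) (simp add: coeff_map_poly)

lemma map_poly_of_real_sum_monom:
  "map_poly of_real (\<Sum>i\<in>F. monom (f i) (n i)) = (\<Sum>i\<in>F. monom (complex_of_real (f i)) (n i))"
  by (induction F rule: infinite_finite_induct) (simp_all add: map_poly_of_real_add map_poly_monom)

text \<open>A truncation of \<open>p\<close> may vanish somewhere on the unit circle. Scaling its \<open>k\<close>-th coefficient
  by \<open>\<rho>\<^sup>k\<close> scales the zeros by \<open>\<rho>\<close> and moves them off the circle.\<close>

lemma causal_tf_approximation:
  assumes p: "p summable_on UNIV" "causal p" and \<epsilon>: "\<epsilon> > 0"
  obtains p' where "p' \<in> causal_tf_set" "(\<Sum>\<^sub>\<infinity>k. \<bar>p k - p' k\<bar>) \<le> \<epsilon>"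
proof -
  obtain F0 where F0: "finite F0" "\<And>G. finite G \<Longrightarrow> F0 \<subseteq> G \<Longrightarrow> (\<Sum>\<^sub>\<infinity>k\<in>-G. \<bar>p k\<bar>) \<le> \<epsilon> / 2"
    using summable_tail[OF p(1), of "\<epsilon> / 2"] \<epsilon> by auto
  obtain m where m: "\<And>k. k \<in> F0 \<Longrightarrow> \<bar>k\<bar> \<le> m"
    using F0(1) by (metis finite_imageI Max_ge imageI)
  define n where "n = nat m"
  define G where "G = int ` {..n}"
  have G: "finite G" by (simp add: G_def)
  have mem: "k \<in> G \<longleftrightarrow> 0 \<le> k \<and> k \<le> int n" for k
    by (auto simp: G_def image_iff intro!: bexI[of _ "nat k"])
  \<comment> \<open>\<open>F0\<close> may contain negative indices, which \<open>G\<close> leaves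
    out. As \<open>p\<close> vanishes there, they can be added to \<open>G\<close> without changing
    the tail.\<close>
  have tail: "(\<Sum>\<^sub>\<infinity>k\<in>-G. \<bar>p k\<bar>) \<le> \<epsilon> / 2"
  proof -
    have "(\<Sum>\<^sub>\<infinity>k\<in>-G. \<bar>p k\<bar>) = (\<Sum>\<^sub>\<infinity>k\<in>-(G \<union> F0). \<bar>p k\<bar>)"
    proof (rule infsum_cong_neutral)
      fix k assume "k \<in> - G - - (G \<union> F0)"
      then have "k < 0" using m[of k] by (auto simp: mem n_def split: if_splits)
      then show "\<bar>p k\<bar> = 0" using p(2) by (simp add: causal_def)
    qed auto
    then show ?thesis using F0(2)[of "G \<union> F0"] F0(1) G by simp
  qed
  \<comment> \<open>Multiplying the truncated transform by z^n gives the polynomial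
    \<open>N0\<close>. Scaling moves a root w of it to \<rho> w, which lies on the circle exactly if
    \<rho> = 1 / |w|; these values form \<open>bad\<close>. A root w = 0 contributes 1 / 0 = 0,
    which no positive \<rho> meets.\<close>
  define N0 where "N0 = (\<Sum>k\<le>n. monom (complex_of_real (p (int k))) (n - k))"
  define bad where "bad = (\<lambda>z. 1 / norm z) ` {z. poly N0 z = 0}"
  define c where "c \<rho> = (\<Sum>k\<le>n. \<bar>p (int k) - p (int k) * \<rho> ^ k\<bar>)" for \<rho>
  \<comment> \<open>The coefficient error \<open>c\<close> is continuous and vanishes at 1, so it is
    small on a whole interval to the left of 1. Such an interval is infinite, whereas
    \<open>bad\<close> is finite unless \<open>N0 = 0\<close>.\<close>
  obtain \<rho> where \<rho>: "0 < \<rho>" "c \<rho> \<le> \<epsilon> / 2" "N0 \<noteq> 0 \<Longrightarrow> \<rho> \<notin> bad"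
  proof -
    have "isCont c 1" unfolding c_def by (intro continuous_intros)
    then have "c \<midarrow>1\<rightarrow> 0" by (simp add: isCont_def c_def)
    then obtain \<delta> where \<delta>: "\<delta> > 0" "\<And>\<rho>. \<rho> \<noteq> 1 \<Longrightarrow> \<bar>\<rho> - 1\<bar> < \<delta> \<Longrightarrow> \<bar>c \<rho>\<bar> < \<epsilon> / 2"
      using LIM_D[of c 0 1 "\<epsilon> / 2"] \<epsilon> by auto
    have "infinite {max 0 (1 - \<delta>)<..<1}" using \<delta>(1) by (simp add: infinite_Ioo)
    moreover have "finite (if N0 = 0 then {} else bad)"
      using poly_roots_finite[of N0] by (simp add: bad_def)
    ultimately have "infinite ({max 0 (1 - \<delta>)<..<1} - (if N0 = 0 then {} else bad))"
      by (intro Diff_infinite_finite)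
    then obtain \<rho> where "\<rho> \<in> {max 0 (1 - \<delta>)<..<1} - (if N0 = 0 then {} else bad)"
      by (metis finite.emptyI equals0I)
    then show thesis using \<delta>(2)[of \<rho>] by (intro that[of \<rho>]) (auto split: if_splits)
  qed
  define p' where "p' k = (if k \<in> G then p k * \<rho> ^ nat k else 0)" for k
  define N where "N = (\<Sum>k\<le>n. monom (p (int k) * \<rho> ^ k) (n - k))"
  have N_eq: "map_poly of_real N = (\<Sum>k\<le>n. monom (complex_of_real (p (int k) * \<rho> ^ k)) (n - k))"
    unfolding N_def by (rule map_poly_of_real_sum_monom)
  have "p' \<in> tf_set"
    unfolding tf_set_def mem_Collect_eq
  proof (rule exI[of _ N], rule exI[of _ "monom 1 n"], intro conjI allI impI)
    fix z :: complex assume z: "norm z = 1"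
    then have z0: "z \<noteq> 0" by auto
    have D: "poly (map_poly of_real (monom 1 n)) z = z ^ n"
      by (simp add: map_poly_monom poly_monom)
    then show "poly (map_poly of_real (monom 1 n)) z \<noteq> 0" using z0 by simp
    have coeff_eq: "complex_of_real (p (int k) * \<rho> ^ k) * z ^ (n - k) / z ^ n
        = of_real (p' (int k)) * z powi (- int k)" if "k \<le> n" for k
      using that z0 by (simp add: p'_def mem power_int_minus power_diff field_simps)
    have "((\<lambda>k. of_real (p' k) * z powi (- k)) has_sum (\<Sum>k\<in>G. of_real (p' k) * z powi (- k))) UNIV"
      by (rule has_sum_finite_neutralI) (use G in \<open>auto simp: p'_def\<close>)
    also have "(\<Sum>k\<in>G. of_real (p' k) * z powi (- k)) = (\<Sum>k\<le>n. of_real (p' (int k)) * z powi (- int k))"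
      unfolding G_def by (subst sum.reindex) (auto simp: inj_on_def)
    also have "\<dots> = poly (map_poly of_real N) z / z ^ n"
      unfolding N_eq poly_sum poly_monom sum_divide_distrib by (intro sum.cong refl) (simp add: coeff_eq del: of_real_mult)
    finally show "((\<lambda>k. of_real (p' k) * z powi (- k)) has_sum
        poly (map_poly of_real N) z / poly (map_poly of_real (monom 1 n)) z) UNIV"
      by (simp only: D)
  next
    show "N = 0 \<or> (\<forall>z::complex. norm z = 1 \<longrightarrow> poly (map_poly of_real N) z \<noteq> 0)"
    proof (cases "N0 = 0")
      case True
      \<comment> \<open>The truncation vanishes altogether here, and \<open>tf_set\<close> admits
        the zero transfer function.\<close>
      have "p (int k) = 0" if "k \<le> n" for k
      proof -
        have "coeff N0 (n - k) = (\<Sum>l\<le>n. if l = k then of_real (p (int l)) else 0)"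
          unfolding N0_def coeff_sum by (intro sum.cong refl) (use that in auto)
        then show ?thesis using True that by simp
      qed
      then show ?thesis by (simp add: N_def)
    next
      case False
      have "poly (map_poly of_real N) z \<noteq> 0" if z: "norm z = 1" for z :: complex
      proof
        assume 0: "poly (map_poly of_real N) z = 0"
        have "poly (map_poly of_real N) z = of_real \<rho> ^ n * poly N0 (z / of_real \<rho>)"
          unfolding N_eq N0_def poly_sum poly_monom sum_distrib_left
        proof (intro sum.cong refl)
          fix k assume "k \<in> {..n}"
          then show "complex_of_real (p (int k) * \<rho> ^ k) * z ^ (n - k)
              = of_real \<rho> ^ n * (of_real (p (int k)) * (z / of_real \<rho>) ^ (n - k))"
            using \<rho>(1) by (simp add: power_divide power_diff field_simps)
        qed
        then have "poly N0 (z / of_real \<rho>) = 0" using 0 \<rho>(1) by simp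
        then have "1 / norm (z / of_real \<rho>) \<in> bad" by (auto simp: bad_def)
        then show False using \<rho> False z by (simp add: norm_divide)
      qed
      then show ?thesis by blast
    qed
  qed
  moreover have "causal p'" by (simp add: causal_def p'_def mem)
  ultimately have "p' \<in> causal_tf_set" by (simp add: causal_tf_set_def)
  moreover have "(\<Sum>\<^sub>\<infinity>k. \<bar>p k - p' k\<bar>) \<le> \<epsilon>"
  proof -
    have s: "(\<lambda>k. \<bar>p k - p' k\<bar>) summable_on UNIV"
      using tf_set_summable[OF \<open>p' \<in> tf_set\<close>] p(1) by (simp add: summable_on_diff)
    have "(\<Sum>\<^sub>\<infinity>k. \<bar>p k - p' k\<bar>) = (\<Sum>k\<in>G. \<bar>p k - p' k\<bar>) + (\<Sum>\<^sub>\<infinity>k\<in>-G. \<bar>p k - p' k\<bar>)"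
      using infsum_Un_disjoint[of "\<lambda>k. \<bar>p k - p' k\<bar>" G "- G"]
        summable_on_subset_banach[OF s subset_UNIV, of "- G"] G by simp
    also have "(\<Sum>k\<in>G. \<bar>p k - p' k\<bar>) = c \<rho>"
      unfolding G_def c_def by (subst sum.reindex) (auto simp: inj_on_def p'_def mem)
    also have "(\<Sum>\<^sub>\<infinity>k\<in>-G. \<bar>p k - p' k\<bar>) = (\<Sum>\<^sub>\<infinity>k\<in>-G. \<bar>p k\<bar>)"
      by (intro infsum_cong) (simp add: p'_def)
    finally show ?thesis using \<rho>(2) tail by linarith
  qed
  ultimately show thesis by (rule that)
qed

section \<open>Filtering of second-order processes\<close>

text \<open>The enumeration \<open>int_decode\<close> turns unordered sums over the integers into
  series, for which the convergence theorems of integration are available.\<close>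

lemma summable_on_int_iff:
  fixes f :: "int \<Rightarrow> real"
  shows "f summable_on UNIV \<longleftrightarrow> summable (\<lambda>n. \<bar>f (int_decode n)\<bar>)"
proof -
  have "f summable_on UNIV \<longleftrightarrow> (\<lambda>k. \<bar>f k\<bar>) summable_on UNIV" by simp
  also have "\<dots> \<longleftrightarrow> (\<lambda>n. \<bar>f (int_decode n)\<bar>) summable_on UNIV"
    by (rule summable_on_reindex_bij_betw[OF bij_int_decode, symmetric])
  also have "\<dots> \<longleftrightarrow> summable (\<lambda>n. \<bar>f (int_decode n)\<bar>)"
    by (rule summable_on_UNIV_nonneg_real_iff) simp
  finally show ?thesis .
qed

lemma infsum_int_eq_suminf:
  fixes f :: "int \<Rightarrow> real"
  assumes "f summable_on UNIV"
  shows "infsum f UNIV = (\<Sum>n. f (int_decode n))"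
proof -
  have "((\<lambda>n. f (int_decode n)) has_sum infsum f UNIV) UNIV"
    using has_sum_reindex_bij_betw[OF bij_int_decode, of f] has_sum_infsum[OF assms] by simp
  then show ?thesis by (rule sums_unique[OF has_sum_imp_sums])
qed

text \<open>\<open>infsum\<close> is 0 where the sum diverges, and divergence is a measurable event:
  the series of absolute values in \<open>ennreal\<close> equals \<open>top\<close>.\<close>

lemma borel_measurable_infsum_int [measurable (raw)]:
  fixes f :: "int \<Rightarrow> 'w \<Rightarrow> real"
  assumes [measurable]: "\<And>k. f k \<in> borel_measurable M"
  shows "(\<lambda>\<omega>. \<Sum>\<^sub>\<infinity>k. f k \<omega>) \<in> borel_measurable M"
proof -
  have s: "(\<lambda>k. f k \<omega>) summable_on UNIV \<longleftrightarrow> (\<Sum>n. ennreal \<bar>f (int_decode n) \<omega>\<bar>) \<noteq> top" for \<omega>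
    unfolding summable_on_int_iff
    by (rule iffI; erule ennreal_suminf_neq_top summable_suminf_not_top[rotated]; rule abs_ge_zero)
  have "(\<lambda>\<omega>. \<Sum>\<^sub>\<infinity>k. f k \<omega>)
      = (\<lambda>\<omega>. if (\<Sum>n. ennreal \<bar>f (int_decode n) \<omega>\<bar>) \<noteq> top then \<Sum>n. f (int_decode n) \<omega> else 0)"
  proof
    show "(\<Sum>\<^sub>\<infinity>k. f k \<omega>)
        = (if (\<Sum>n. ennreal \<bar>f (int_decode n) \<omega>\<bar>) \<noteq> top then \<Sum>n. f (int_decode n) \<omega> else 0)" for \<omega>
      unfolding s[symmetric] by (cases "(\<lambda>k. f k \<omega>) summable_on UNIV")
        (simp_all only: infsum_int_eq_suminf infsum_not_exists if_True if_False simp_thms)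
  qed
  moreover have "(\<lambda>\<omega>. if (\<Sum>n. ennreal \<bar>f (int_decode n) \<omega>\<bar>) \<noteq> top then \<Sum>n. f (int_decode n) \<omega> else 0)
      \<in> borel_measurable M"
    by measurable
  ultimately show ?thesis by (simp only:)
qed

text \<open>Tonelli: the sum of the absolute values has finite expectation and is therefore almost
  surely finite. The almost sure convergence of filtered processes rests on this.\<close>

lemma integral_infsum_int:
  fixes f :: "int \<Rightarrow> 'w \<Rightarrow> real"
  assumes int: "\<And>k. integrable M (f k)" and sum: "(\<lambda>k. \<integral>\<omega>. \<bar>f k \<omega>\<bar> \<partial>M) summable_on UNIV"
  shows "AE \<omega> in M. (\<lambda>k. f k \<omega>) summable_on UNIV"
    and "integrable M (\<lambda>\<omega>. \<Sum>\<^sub>\<infinity>k. f k \<omega>)"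
    and "(\<integral>\<omega>. (\<Sum>\<^sub>\<infinity>k. f k \<omega>) \<partial>M) = (\<Sum>\<^sub>\<infinity>k. \<integral>\<omega>. f k \<omega> \<partial>M)"
proof -
  let ?g = "\<lambda>n \<omega>. f (int_decode n) \<omega>"
  have sum': "summable (\<lambda>n. \<integral>\<omega>. norm (?g n \<omega>) \<partial>M)"
    using sum by (simp add: summable_on_int_iff)
  have meas [measurable]: "?g n \<in> borel_measurable M" "f k \<in> borel_measurable M" for n k
    using int by auto
  have "(\<integral>\<^sup>+\<omega>. (\<Sum>n. ennreal (norm (?g n \<omega>))) \<partial>M) = (\<Sum>n. \<integral>\<^sup>+\<omega>. ennreal (norm (?g n \<omega>)) \<partial>M)"
    by (rule nn_integral_suminf) simp
  also have "\<dots> = (\<Sum>n. ennreal (\<integral>\<omega>. norm (?g n \<omega>) \<partial>M))"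
    using int by (intro arg_cong[where f=suminf] ext nn_integral_eq_integral) auto
  also have "\<dots> \<noteq> top"
    using sum' by (rule ennreal_suminf_neq_top) simp
  finally have "AE \<omega> in M. (\<Sum>n. ennreal (norm (?g n \<omega>))) \<noteq> \<infinity>"
    by (intro nn_integral_noteq_infinite) (auto simp: infinity_ennreal_def)
  then show ae: "AE \<omega> in M. (\<lambda>k. f k \<omega>) summable_on UNIV"
    by eventually_elim
       (simp add: summable_on_int_iff infinity_ennreal_def summable_suminf_not_top)
  have ae': "AE \<omega> in M. summable (\<lambda>n. norm (?g n \<omega>))"
    using ae by eventually_elim (simp add: summable_on_int_iff)
  have eq: "AE \<omega> in M. (\<Sum>n. ?g n \<omega>) = (\<Sum>\<^sub>\<infinity>k. f k \<omega>)"
    using ae by eventually_elim (simp add: infsum_int_eq_suminf)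
  have i: "integrable M (\<lambda>\<omega>. \<Sum>n. ?g n \<omega>)"
    using int ae' sum' by (intro integrable_suminf) auto
  then show "integrable M (\<lambda>\<omega>. \<Sum>\<^sub>\<infinity>k. f k \<omega>)"
    using eq by (subst (asm) integrable_cong_AE) auto
  have "(\<integral>\<omega>. (\<Sum>\<^sub>\<infinity>k. f k \<omega>) \<partial>M) = (\<integral>\<omega>. (\<Sum>n. ?g n \<omega>) \<partial>M)"
    using eq by (intro integral_cong_AE) auto
  also have "\<dots> = (\<Sum>n. \<integral>\<omega>. ?g n \<omega> \<partial>M)"
    using int ae' sum' by (intro integral_suminf) auto
  also have "\<dots> = (\<Sum>\<^sub>\<infinity>k. \<integral>\<omega>. f k \<omega> \<partial>M)"
  proof (rule infsum_int_eq_suminf[symmetric])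
    show "(\<lambda>k. \<integral>\<omega>. f k \<omega> \<partial>M) summable_on UNIV"
      unfolding summable_on_int_iff
      by (rule summable_comparison_test'[OF sum', of 0]) simp
  qed
  finally show "(\<integral>\<omega>. (\<Sum>\<^sub>\<infinity>k. f k \<omega>) \<partial>M) = (\<Sum>\<^sub>\<infinity>k. \<integral>\<omega>. f k \<omega> \<partial>M)" .
qed

section \<open>Square-integrable variables and processes with bounded second moments\<close>

definition l2 :: "'w measure \<Rightarrow> ('w \<Rightarrow> real) \<Rightarrow> bool" where
  "l2 M f \<longleftrightarrow> f \<in> borel_measurable M \<and> integrable M (\<lambda>\<omega>. (f \<omega>)\<^sup>2)"

text \<open>The elementary bound |a b| <= a^2 + b^2 takes the place of Cauchy-Schwarz: only its
  uniformity in time matters when such integrals are weighted by a summable filter.\<close>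

lemma l2_mult:
  assumes "l2 M f" "l2 M g"
  shows "integrable M (\<lambda>\<omega>. f \<omega> * g \<omega>)"
    and "(\<integral>\<omega>. \<bar>f \<omega> * g \<omega>\<bar> \<partial>M) \<le> (\<integral>\<omega>. (f \<omega>)\<^sup>2 \<partial>M) + (\<integral>\<omega>. (g \<omega>)\<^sup>2 \<partial>M)"
proof -
  have le: "\<bar>a * b\<bar> \<le> a\<^sup>2 + b\<^sup>2" for a b :: real
  proof -
    have "2 * (\<bar>a\<bar> * \<bar>b\<bar>) \<le> a\<^sup>2 + b\<^sup>2"
      using zero_le_power2[of "\<bar>a\<bar> - \<bar>b\<bar>"] by (simp add: power2_diff)
    then show ?thesis by (simp add: abs_mult) (smt (verit) mult_nonneg_nonneg abs_ge_zero)
  qed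
  have i: "integrable M (\<lambda>\<omega>. (f \<omega>)\<^sup>2 + (g \<omega>)\<^sup>2)"
    using assms by (auto simp: l2_def)
  have m [measurable]: "f \<in> borel_measurable M" "g \<in> borel_measurable M"
    using assms by (auto simp: l2_def)
  show p: "integrable M (\<lambda>\<omega>. f \<omega> * g \<omega>)"
    by (rule Bochner_Integration.integrable_bound[OF i]) (use le in \<open>auto intro!: AE_I2 order_trans[OF le] abs_ge_self\<close>)
  have "(\<integral>\<omega>. \<bar>f \<omega> * g \<omega>\<bar> \<partial>M) \<le> (\<integral>\<omega>. (f \<omega>)\<^sup>2 + (g \<omega>)\<^sup>2 \<partial>M)"
    using p i le by (intro integral_mono) auto
  then show "(\<integral>\<omega>. \<bar>f \<omega> * g \<omega>\<bar> \<partial>M) \<le> (\<integral>\<omega>. (f \<omega>)\<^sup>2 \<partial>M) + (\<integral>\<omega>. (g \<omega>)\<^sup>2 \<partial>M)"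
    using assms by (simp add: l2_def)
qed

lemma l2_add: assumes "l2 M f" "l2 M g" shows "l2 M (\<lambda>\<omega>. f \<omega> + g \<omega>)"
  using assms l2_mult(1)[OF assms] unfolding l2_def
  by (auto simp: power2_sum mult.assoc)

lemma l2_cmult: assumes "l2 M f" shows "l2 M (\<lambda>\<omega>. c * f \<omega>)"
  using assms unfolding l2_def by (auto simp: power_mult_distrib)

lemma l2_zero [simp]: "l2 M (\<lambda>_. 0)"
  by (simp add: l2_def)

lemma l2_diff: assumes "l2 M f" "l2 M g" shows "l2 M (\<lambda>\<omega>. f \<omega> - g \<omega>)"
  using l2_add[OF assms(1) l2_cmult[OF assms(2), of "-1"]] by simp

text \<open>What the calculus of filters uses of stationarity: a bound on the second moments that is
  uniform in time. Finite sums and stable filters preserve it.\<close>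

definition second_order :: "'w measure \<Rightarrow> 'w process \<Rightarrow> bool" where
  "second_order M x \<longleftrightarrow> (\<forall>t. l2 M (x t)) \<and> (\<exists>K. \<forall>t. (\<integral>\<omega>. (x t \<omega>)\<^sup>2 \<partial>M) \<le> K)"

lemma second_order_l2: "second_order M x \<Longrightarrow> l2 M (x t)"
  by (simp add: second_order_def)

lemma summable_on_real_bound:
  fixes f g :: "'b \<Rightarrow> real"
  assumes "g summable_on A" "\<And>x. x \<in> A \<Longrightarrow> \<bar>f x\<bar> \<le> g x"
  shows "f summable_on A"
  using Infinite_Sum.abs_summable_on_comparison_test'[OF assms(1), of f] assms(2) by simp

lemma infsum_finite_sum:
  fixes f :: "'b \<Rightarrow> 'a \<Rightarrow> real"
  assumes "\<And>i. i \<in> F \<Longrightarrow> f i summable_on A"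
  shows "(\<Sum>\<^sub>\<infinity>x\<in>A. \<Sum>i\<in>F. f i x) = (\<Sum>i\<in>F. infsum (f i) A)"
  using assms
proof (induction F rule: infinite_finite_induct)
  case (insert i F)
  then have "(\<lambda>x. \<Sum>i\<in>F. f i x) summable_on A" by (intro summable_on_sum) auto
  then show ?case using insert by (simp add: infsum_add)
qed simp_all

context prob_space
begin

lemma second_order_sum:
  assumes "\<And>i. i \<in> F \<Longrightarrow> second_order M (x i)"
  shows "second_order M (\<lambda>t \<omega>. \<Sum>i\<in>F. x i t \<omega>)"
  using assms
proof (induction F rule: infinite_finite_induct)
  case (insert i F)
  have "second_order M (\<lambda>t \<omega>. u t \<omega> + v t \<omega>)" if u: "second_order M u" and v: "second_order M v" for u v
  proof -
    obtain K L where K: "\<And>t. (\<integral>\<omega>. (u t \<omega>)\<^sup>2 \<partial>M) \<le> K" and L: "\<And>t. (\<integral>\<omega>. (v t \<omega>)\<^sup>2 \<partial>M) \<le> L"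
      using u v by (auto simp: second_order_def)
    have "(\<integral>\<omega>. (u t \<omega> + v t \<omega>)\<^sup>2 \<partial>M) \<le> 2 * (K + L)" for t
    proof -
      note l = second_order_l2[OF u, of t] second_order_l2[OF v, of t]
      have "(a + b)\<^sup>2 \<le> 2 * (a\<^sup>2 + b\<^sup>2)" for a b :: real
        using zero_le_power2[of "a - b"] by (simp add: power2_sum power2_diff)
      then have "(\<integral>\<omega>. (u t \<omega> + v t \<omega>)\<^sup>2 \<partial>M) \<le> (\<integral>\<omega>. 2 * ((u t \<omega>)\<^sup>2 + (v t \<omega>)\<^sup>2) \<partial>M)"
        using l l2_add[OF l] by (intro integral_mono) (auto simp: l2_def)
      also have "\<dots> = 2 * ((\<integral>\<omega>. (u t \<omega>)\<^sup>2 \<partial>M) + (\<integral>\<omega>. (v t \<omega>)\<^sup>2 \<partial>M))"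
        using l by (simp add: l2_def)
      also have "\<dots> \<le> 2 * (K + L)"
        by (intro mult_left_mono add_mono K L) simp
      finally show ?thesis .
    qed
    then show ?thesis using u v by (auto simp: second_order_def intro: l2_add)
  qed
  from this[of "x i" "\<lambda>t \<omega>. \<Sum>i\<in>F. x i t \<omega>"] show ?case
    using insert by simp
qed (auto simp: second_order_def)

lemma AE_summable_filter:
  assumes p: "p summable_on UNIV" and x: "second_order M x"
  shows "AE \<omega> in M. (\<lambda>k. p (t - k) * x k \<omega>) summable_on UNIV"
proof (rule integral_infsum_int(1))
  obtain K where K: "\<And>t. (\<integral>\<omega>. (x t \<omega>)\<^sup>2 \<partial>M) \<le> K"
    using x by (auto simp: second_order_def)
  \<comment> \<open>Paired with the constant 1, \<open>l2_mult\<close> bounds the first absolute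
    moments by \<open>K + 1\<close>, where the 1 is the total mass of the probability space.\<close>
  have one: "l2 M (\<lambda>_. 1)" by (simp add: l2_def)
  have i: "integrable M (x k)" and b: "(\<integral>\<omega>. \<bar>x k \<omega>\<bar> \<partial>M) \<le> K + 1" for k
    using l2_mult[OF second_order_l2[OF x, of k] one] K[of k] by (simp_all add: prob_space)
  show "integrable M (\<lambda>\<omega>. p (t - k) * x k \<omega>)" for k
    using i by simp
  have s: "(\<lambda>k. \<bar>p (t - k)\<bar> * (K + 1)) summable_on UNIV"
    using p summable_on_int_shift(1)[of "\<lambda>k. \<bar>p k\<bar>" t] by (intro summable_on_cmult_left) simp
  show "(\<lambda>k. \<integral>\<omega>. \<bar>p (t - k) * x k \<omega>\<bar> \<partial>M) summable_on UNIV"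
    by (rule summable_on_real_bound[OF s]) (use b in \<open>simp add: abs_mult mult_left_mono\<close>)
qed

lemma measurable_tf_apply:
  assumes "\<And>k. x k \<in> borel_measurable M"
  shows "tf_apply p x t \<in> borel_measurable M"
  using assms unfolding tf_apply_def by measurable

text \<open>With C the sum of the |p k|, Cauchy-Schwarz with the weights |p k| = sqrt |p k| * sqrt
  |p k| bounds the squared output by C times the sum of the |p (t - k)| (x k)^2, and the expectation
  contributes the second factor C. That the bound is quadratic in C later makes a small change of
  the filter a small change of the estimate.\<close>

lemma tf_apply_second_moment:
  assumes p: "p summable_on UNIV" and x: "second_order M x" and K: "\<And>t. (\<integral>\<omega>. (x t \<omega>)\<^sup>2 \<partial>M) \<le> K"
  shows "l2 M (tf_apply p x t)"
    and "(\<integral>\<omega>. (tf_apply p x t \<omega>)\<^sup>2 \<partial>M) \<le> (\<Sum>\<^sub>\<infinity>k. \<bar>p k\<bar>)\<^sup>2 * K"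
proof -
  let ?C = "\<Sum>\<^sub>\<infinity>k. \<bar>p k\<bar>"
  define g where "g k \<omega> = \<bar>p (t - k)\<bar> * (x k \<omega>)\<^sup>2" for k \<omega>
  have x2: "integrable M (\<lambda>\<omega>. (x k \<omega>)\<^sup>2)" and xm [measurable]: "x k \<in> borel_measurable M" for k
    using second_order_l2[OF x, of k] by (auto simp: l2_def)
  have p': "(\<lambda>k. \<bar>p (t - k)\<bar>) summable_on UNIV" and C: "(\<Sum>\<^sub>\<infinity>k. \<bar>p (t - k)\<bar>) = ?C"
    using p summable_on_int_shift(1)[of "\<lambda>k. \<bar>p k\<bar>" t] infsum_int_shift(1)[of "\<lambda>k. \<bar>p k\<bar>" t] by simp_all
  have C0: "?C \<ge> 0" by (intro infsum_nonneg) simp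
  have gi: "integrable M (\<lambda>\<omega>. g k \<omega>)" for k
    using x2[of k] unfolding g_def by simp
  have eg: "(\<integral>\<omega>. g k \<omega> \<partial>M) \<le> \<bar>p (t - k)\<bar> * K" for k
    using K[of k] by (simp add: g_def mult_left_mono)
  have s: "(\<lambda>k. \<bar>p (t - k)\<bar> * K) summable_on UNIV"
    using p' by (rule summable_on_cmult_left)
  have gs: "(\<lambda>k. \<integral>\<omega>. \<bar>g k \<omega>\<bar> \<partial>M) summable_on UNIV"
    by (rule summable_on_real_bound[OF s]) (use eg in \<open>simp add: g_def\<close>)
  note G = integral_infsum_int[OF gi gs]
  have "AE \<omega> in M. (tf_apply p x t \<omega>)\<^sup>2 \<le> ?C * (\<Sum>\<^sub>\<infinity>k. g k \<omega>)"
    using AE_summable_filter[OF p x, of t] G(1)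
  proof eventually_elim
    case (elim \<omega>)
    \<comment> \<open>Cauchy-Schwarz is applied to finite partial sums, and the bound passes to
      their limit.\<close>
    have "((\<lambda>F. (\<Sum>k\<in>F. p (t - k) * x k \<omega>)\<^sup>2) \<longlongrightarrow> (tf_apply p x t \<omega>)\<^sup>2) (finite_subsets_at_top UNIV)"
      using has_sum_infsum[OF elim(1)] unfolding has_sum_def tf_apply_def by (rule tendsto_power)
    moreover have "(\<Sum>k\<in>F. p (t - k) * x k \<omega>)\<^sup>2 \<le> ?C * (\<Sum>\<^sub>\<infinity>k. g k \<omega>)" if F: "finite F" for F
    proof -
      have "\<bar>\<Sum>k\<in>F. p (t - k) * x k \<omega>\<bar> \<le> (\<Sum>k\<in>F. sqrt \<bar>p (t - k)\<bar> * (sqrt \<bar>p (t - k)\<bar> * \<bar>x k \<omega>\<bar>))"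
      proof -
        have "\<bar>p (t - k) * x k \<omega>\<bar> = sqrt \<bar>p (t - k)\<bar> * (sqrt \<bar>p (t - k)\<bar> * \<bar>x k \<omega>\<bar>)" for k
          unfolding mult.assoc[symmetric] by (simp add: abs_mult)
        then show ?thesis
          by (metis (no_types, lifting) sum_abs sum.cong)
      qed
      then have "(\<Sum>k\<in>F. p (t - k) * x k \<omega>)\<^sup>2 \<le> (\<Sum>k\<in>F. sqrt \<bar>p (t - k)\<bar> * (sqrt \<bar>p (t - k)\<bar> * \<bar>x k \<omega>\<bar>))\<^sup>2"
        by (rule abs_le_square_iff[THEN iffD1, OF order_trans[OF _ abs_ge_self]])
      also have "\<dots> \<le> (\<Sum>k\<in>F. (sqrt \<bar>p (t - k)\<bar>)\<^sup>2) * (\<Sum>k\<in>F. (sqrt \<bar>p (t - k)\<bar> * \<bar>x k \<omega>\<bar>)\<^sup>2)"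
        by (rule Cauchy_Schwarz_ineq_sum)
      also have "\<dots> = (\<Sum>k\<in>F. \<bar>p (t - k)\<bar>) * (\<Sum>k\<in>F. g k \<omega>)"
        by (simp add: g_def power_mult_distrib)
      also have "\<dots> \<le> ?C * (\<Sum>\<^sub>\<infinity>k. g k \<omega>)"
      proof (rule mult_mono)
        show "(\<Sum>k\<in>F. \<bar>p (t - k)\<bar>) \<le> ?C"
          unfolding C[symmetric] using p' F by (intro finite_sum_le_infsum) auto
        show "(\<Sum>k\<in>F. g k \<omega>) \<le> (\<Sum>\<^sub>\<infinity>k. g k \<omega>)"
          using elim(2) F by (intro finite_sum_le_infsum) (auto simp: g_def)
      qed (auto simp: C0 g_def intro: sum_nonneg)
      finally show ?thesis .
    qed
    then have "\<forall>\<^sub>F F in finite_subsets_at_top UNIV. (\<Sum>k\<in>F. p (t - k) * x k \<omega>)\<^sup>2 \<le> ?C * (\<Sum>\<^sub>\<infinity>k. g k \<omega>)"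
      by (intro eventually_finite_subsets_at_top_weakI) simp
    ultimately show ?case
      by (rule tendsto_upperbound) simp
  qed
  moreover have gint: "integrable M (\<lambda>\<omega>. ?C * (\<Sum>\<^sub>\<infinity>k. g k \<omega>))"
    using G(2) by simp
  moreover have [measurable]: "tf_apply p x t \<in> borel_measurable M"
    by (rule measurable_tf_apply) simp
  ultimately have int: "integrable M (\<lambda>\<omega>. (tf_apply p x t \<omega>)\<^sup>2)"
    by (intro Bochner_Integration.integrable_bound[OF gint]) (auto elim: eventually_mono)
  then show "l2 M (tf_apply p x t)" by (simp add: l2_def)
  have "(\<integral>\<omega>. (tf_apply p x t \<omega>)\<^sup>2 \<partial>M) \<le> (\<integral>\<omega>. ?C * (\<Sum>\<^sub>\<infinity>k. g k \<omega>) \<partial>M)"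
    using int gint \<open>AE \<omega> in M. (tf_apply p x t \<omega>)\<^sup>2 \<le> ?C * (\<Sum>\<^sub>\<infinity>k. g k \<omega>)\<close> by (rule integral_mono_AE)
  also have "\<dots> = ?C * (\<Sum>\<^sub>\<infinity>k. \<integral>\<omega>. g k \<omega> \<partial>M)"
    using G(3) by simp
  also have "\<dots> \<le> ?C * (\<Sum>\<^sub>\<infinity>k. \<bar>p (t - k)\<bar> * K)"
  proof (intro mult_left_mono C0 infsum_mono s eg)
    show "(\<lambda>k. \<integral>\<omega>. g k \<omega> \<partial>M) summable_on UNIV"
      using gs by (simp add: g_def)
  qed
  also have "\<dots> = ?C\<^sup>2 * K"
    by (simp add: infsum_cmult_left' C power2_eq_square)
  finally show "(\<integral>\<omega>. (tf_apply p x t \<omega>)\<^sup>2 \<partial>M) \<le> ?C\<^sup>2 * K" .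
qed

lemma second_order_tf_apply:
  assumes "p summable_on UNIV" "second_order M x"
  shows "second_order M (tf_apply p x)"
proof -
  obtain K where "\<And>t. (\<integral>\<omega>. (x t \<omega>)\<^sup>2 \<partial>M) \<le> K"
    using assms(2) by (auto simp: second_order_def)
  from tf_apply_second_moment[OF assms this] show ?thesis
    unfolding second_order_def by blast
qed

lemma tf_apply_cong_AE:
  assumes "\<And>t. AE \<omega> in M. x t \<omega> = x' t \<omega>"
  shows "AE \<omega> in M. tf_apply p x t \<omega> = tf_apply p x' t \<omega>"
proof -
  have "AE \<omega> in M. \<forall>k. x k \<omega> = x' k \<omega>" using assms by (simp add: AE_all_countable)
  then show ?thesis by eventually_elim (simp add: tf_apply_def)
qed

lemma tf_apply_sum_process:
  assumes "p summable_on UNIV" "finite F" "\<And>i. i \<in> F \<Longrightarrow> second_order M (x i)"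
  shows "AE \<omega> in M. tf_apply p (\<lambda>t \<omega>. \<Sum>i\<in>F. x i t \<omega>) t \<omega> = (\<Sum>i\<in>F. tf_apply p (x i) t \<omega>)"
proof -
  have "AE \<omega> in M. \<forall>i\<in>F. (\<lambda>k. p (t - k) * x i k \<omega>) summable_on UNIV"
    using assms AE_summable_filter by (intro AE_finite_allI) auto
  then show ?thesis
    by eventually_elim (simp add: tf_apply_def sum_distrib_left infsum_finite_sum)
qed

lemma tf_apply_sum_filter:
  assumes "\<And>i. i \<in> F \<Longrightarrow> p i summable_on UNIV" "finite F" "second_order M x"
  shows "AE \<omega> in M. tf_apply (\<lambda>k. \<Sum>i\<in>F. p i k) x t \<omega> = (\<Sum>i\<in>F. tf_apply (p i) x t \<omega>)"
proof -
  have "AE \<omega> in M. \<forall>i\<in>F. (\<lambda>k. p i (t - k) * x k \<omega>) summable_on UNIV"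
    using assms AE_summable_filter by (intro AE_finite_allI) auto
  then show ?thesis
    by eventually_elim (simp add: tf_apply_def sum_distrib_right infsum_finite_sum)
qed

text \<open>\<open>conv_conv\<close> asks that the sample path be summable against the convolution
  of the absolute values. This convolution is itself a stable filter, so
  \<open>AE_summable_filter\<close> provides the condition almost surely.\<close>

lemma tf_apply_tf_apply:
  assumes p: "p summable_on UNIV" and q: "q summable_on UNIV" and x: "second_order M x"
  shows "AE \<omega> in M. tf_apply p (tf_apply q x) t \<omega> = tf_apply (conv p q) x t \<omega>"
proof -
  have "conv (\<lambda>k. \<bar>p k\<bar>) (\<lambda>k. \<bar>q k\<bar>) summable_on UNIV"
    using p q by (intro summable_conv) simp_all
  from AE_summable_filter[OF this x, of t] show ?thesis
  proof eventually_elim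
    case (elim \<omega>)
    have "conv (\<lambda>k. \<bar>p k\<bar>) (\<lambda>k. \<bar>q k\<bar>) m \<ge> 0" for m
      by (auto simp: conv_def intro: infsum_nonneg)
    then have "(\<lambda>m. conv (\<lambda>k. \<bar>p k\<bar>) (\<lambda>k. \<bar>q k\<bar>) (t - m) * \<bar>x m \<omega>\<bar>)
        = (\<lambda>m. \<bar>conv (\<lambda>k. \<bar>p k\<bar>) (\<lambda>k. \<bar>q k\<bar>) (t - m) * x m \<omega>\<bar>)"
      by (simp add: abs_mult)
    then have "(\<lambda>m. conv (\<lambda>k. \<bar>p k\<bar>) (\<lambda>k. \<bar>q k\<bar>) (t - m) * \<bar>x m \<omega>\<bar>) summable_on UNIV"
      using elim by simp
    then show ?case
      using conv_conv[OF p q, of t "\<lambda>m. x m \<omega>"] by (simp add: tf_apply_conv)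
  qed
qed

text \<open>A filter acts on correlations as it acts on the process. This transports orthogonality
  through filters and links a filter to the spectral density of its input.\<close>

lemma integral_tf_apply_mult:
  assumes p: "p summable_on UNIV" and x: "second_order M x" and w: "l2 M w"
  shows "(\<integral>\<omega>. tf_apply p x t \<omega> * w \<omega> \<partial>M) = (\<Sum>\<^sub>\<infinity>k. p (t - k) * (\<integral>\<omega>. x k \<omega> * w \<omega> \<partial>M))"
proof -
  obtain K where K: "\<And>t. (\<integral>\<omega>. (x t \<omega>)\<^sup>2 \<partial>M) \<le> K"
    using x by (auto simp: second_order_def)
  note xw = l2_mult[OF second_order_l2[OF x] w]
  let ?L = "K + (\<integral>\<omega>. (w \<omega>)\<^sup>2 \<partial>M)"
  have s: "(\<lambda>k. \<bar>p (t - k)\<bar> * ?L) summable_on UNIV"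
    using p summable_on_int_shift(1)[of "\<lambda>k. \<bar>p k\<bar>" t] by (intro summable_on_cmult_left) simp
  have "(\<lambda>k. \<integral>\<omega>. \<bar>p (t - k) * (x k \<omega> * w \<omega>)\<bar> \<partial>M) summable_on UNIV"
  proof (rule summable_on_real_bound[OF s])
    fix k
    have "(\<integral>\<omega>. \<bar>x k \<omega> * w \<omega>\<bar> \<partial>M) \<le> ?L" using xw(2)[of k] K[of k] by linarith
    then show "\<bar>\<integral>\<omega>. \<bar>p (t - k) * (x k \<omega> * w \<omega>)\<bar> \<partial>M\<bar> \<le> \<bar>p (t - k)\<bar> * ?L"
      by (simp add: abs_mult[of "p (t - k)"] mult_left_mono)
  qed
  then have "(\<integral>\<omega>. (\<Sum>\<^sub>\<infinity>k. p (t - k) * (x k \<omega> * w \<omega>)) \<partial>M) = (\<Sum>\<^sub>\<infinity>k. \<integral>\<omega>. p (t - k) * (x k \<omega> * w \<omega>) \<partial>M)"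
    using xw(1) by (intro integral_infsum_int(3)) auto
  then show ?thesis
    by (simp add: tf_apply_def mult.assoc flip: infsum_cmult_left')
qed

end

section \<open>Separation of the innovations\<close>

text \<open>The shape of the elements of \<open>ctfspan\<close>, freed from rationality and
  causality of the filters.\<close>

definition bank :: "'c set \<Rightarrow> ('c \<Rightarrow> tf) \<Rightarrow> ('c \<Rightarrow> 'w process) \<Rightarrow> 'w process" where
  "bank S g y = (\<lambda>t \<omega>. \<Sum>s\<in>S. tf_apply (g s) (y s) t \<omega>)"

definition orthogonal_processes :: "'w measure \<Rightarrow> 'w process \<Rightarrow> 'w process \<Rightarrow> bool" where
  "orthogonal_processes M x x' \<longleftrightarrow> (\<forall>s t. (\<integral>\<omega>. x s \<omega> * x' t \<omega> \<partial>M) = 0)"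

lemma orthogonal_processes_sym: "orthogonal_processes M x x' \<Longrightarrow> orthogonal_processes M x' x"
  by (simp add: orthogonal_processes_def mult.commute)

lemma conv_zero [simp]: "conv p (\<lambda>_. 0) = (\<lambda>_. 0)" "conv (\<lambda>_. 0) p = (\<lambda>_. 0)"
  by (simp_all add: fun_eq_iff conv_def)

lemma tf_apply_zero [simp]: "tf_apply (\<lambda>_. 0) x t \<omega> = 0"
  by (simp add: tf_apply_def)

lemma bank_mono_neutral:
  assumes "finite S" "Z \<subseteq> S" "\<And>s. s \<in> S - Z \<Longrightarrow> g s = (\<lambda>_. 0)"
  shows "bank S g y = bank Z g y"
  unfolding bank_def using assms by (intro ext sum.mono_neutral_right) auto

context prob_space
begin

lemma second_order_bank:
  assumes "\<And>s. s \<in> S \<Longrightarrow> g s summable_on UNIV" "\<And>s. s \<in> S \<Longrightarrow> second_order M (y s)"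
  shows "second_order M (bank S g y)"
  unfolding bank_def using assms by (intro second_order_sum second_order_tf_apply)

lemma bank_cong_AE:
  assumes "finite S" "\<And>s t. s \<in> S \<Longrightarrow> AE \<omega> in M. y s t \<omega> = y' s t \<omega>"
  shows "AE \<omega> in M. bank S g y t \<omega> = bank S g y' t \<omega>"
proof -
  have "AE \<omega> in M. \<forall>s\<in>S. tf_apply (g s) (y s) t \<omega> = tf_apply (g s) (y' s) t \<omega>"
    using assms by (intro AE_finite_allI tf_apply_cong_AE) auto
  then show ?thesis by eventually_elim (simp add: bank_def)
qed

text \<open>Composition of banks is the product of a row of filters with a matrix of
  filters.\<close>

lemma bank_bank:
  assumes fin: "finite C" "finite S"
    and p: "\<And>c. c \<in> C \<Longrightarrow> p c summable_on UNIV"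
    and g: "\<And>c s. c \<in> C \<Longrightarrow> s \<in> S \<Longrightarrow> g c s summable_on UNIV"
    and y: "\<And>s. s \<in> S \<Longrightarrow> second_order M (y s)"
  shows "AE \<omega> in M. bank C p (\<lambda>c. bank S (g c) y) t \<omega>
           = bank S (\<lambda>s k. \<Sum>c\<in>C. conv (p c) (g c s) k) y t \<omega>"
proof -
  have 1: "AE \<omega> in M. \<forall>c\<in>C. tf_apply (p c) (bank S (g c) y) t \<omega>
      = (\<Sum>s\<in>S. tf_apply (p c) (tf_apply (g c s) (y s)) t \<omega>)"
    unfolding bank_def using assms
    by (intro AE_finite_allI tf_apply_sum_process second_order_tf_apply) auto
  have 2: "AE \<omega> in M. \<forall>c\<in>C. \<forall>s\<in>S. tf_apply (p c) (tf_apply (g c s) (y s)) t \<omega>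
      = tf_apply (conv (p c) (g c s)) (y s) t \<omega>"
    using assms by (intro AE_finite_allI tf_apply_tf_apply) auto
  have 3: "AE \<omega> in M. \<forall>s\<in>S. tf_apply (\<lambda>k. \<Sum>c\<in>C. conv (p c) (g c s) k) (y s) t \<omega>
      = (\<Sum>c\<in>C. tf_apply (conv (p c) (g c s)) (y s) t \<omega>)"
    using assms by (intro AE_finite_allI tf_apply_sum_filter summable_conv) auto
  from 1 2 3 show ?thesis
  proof eventually_elim
    case (elim \<omega>)
    have "bank C p (\<lambda>c. bank S (g c) y) t \<omega> = (\<Sum>c\<in>C. tf_apply (p c) (bank S (g c) y) t \<omega>)"
      by (simp add: bank_def[of C])
    also have "\<dots> = (\<Sum>c\<in>C. \<Sum>s\<in>S. tf_apply (conv (p c) (g c s)) (y s) t \<omega>)"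
      using elim(1,2) by simp
    also have "\<dots> = (\<Sum>s\<in>S. \<Sum>c\<in>C. tf_apply (conv (p c) (g c s)) (y s) t \<omega>)"
      by (rule sum.swap)
    finally show ?case using elim(3) by (simp add: bank_def[of S])
  qed
qed

lemma bank_add_process:
  assumes "finite S" "\<And>s. s \<in> S \<Longrightarrow> g s summable_on UNIV"
    and "\<And>s. s \<in> S \<Longrightarrow> second_order M (u s)" "\<And>s. s \<in> S \<Longrightarrow> second_order M (v s)"
  shows "AE \<omega> in M. bank S g (\<lambda>s t \<omega>. u s t \<omega> + v s t \<omega>) t \<omega> = bank S g u t \<omega> + bank S g v t \<omega>"
proof -
  have "AE \<omega> in M. \<forall>s\<in>S. (\<lambda>k. g s (t - k) * u s k \<omega>) summable_on UNIV"
    "AE \<omega> in M. \<forall>s\<in>S. (\<lambda>k. g s (t - k) * v s k \<omega>) summable_on UNIV"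
    using assms by (auto intro!: AE_finite_allI AE_summable_filter)
  then show ?thesis
    by eventually_elim (simp add: bank_def tf_apply_def distrib_left infsum_add sum.distrib)
qed

lemma bank_add_filter:
  assumes "finite S" "\<And>s. s \<in> S \<Longrightarrow> g s summable_on UNIV" "\<And>s. s \<in> S \<Longrightarrow> h s summable_on UNIV"
    and "\<And>s. s \<in> S \<Longrightarrow> second_order M (y s)"
  shows "AE \<omega> in M. bank S (\<lambda>s k. g s k + h s k) y t \<omega> = bank S g y t \<omega> + bank S h y t \<omega>"
proof -
  have "AE \<omega> in M. \<forall>s\<in>S. (\<lambda>k. g s (t - k) * y s k \<omega>) summable_on UNIV"
    "AE \<omega> in M. \<forall>s\<in>S. (\<lambda>k. h s (t - k) * y s k \<omega>) summable_on UNIV"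
    using assms by (auto intro!: AE_finite_allI AE_summable_filter)
  then show ?thesis
    by eventually_elim (simp add: bank_def tf_apply_def distrib_right infsum_add sum.distrib)
qed

lemma bank_diff_filter:
  assumes "finite S" "\<And>s. s \<in> S \<Longrightarrow> g s summable_on UNIV" "\<And>s. s \<in> S \<Longrightarrow> h s summable_on UNIV"
    and "\<And>s. s \<in> S \<Longrightarrow> second_order M (y s)"
  shows "AE \<omega> in M. bank S (\<lambda>s k. g s k - h s k) y t \<omega> = bank S g y t \<omega> - bank S h y t \<omega>"
  using bank_add_filter[of S "\<lambda>s k. g s k - h s k" h y t] assms
  by (auto simp: summable_on_diff elim: eventually_mono)

lemma orthogonal_bank:
  assumes "\<And>s. s \<in> S \<Longrightarrow> g s summable_on UNIV" "\<And>s. s \<in> S \<Longrightarrow> second_order M (y s)"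
    and x: "second_order M x" and o: "\<And>s. s \<in> S \<Longrightarrow> orthogonal_processes M (y s) x"
  shows "orthogonal_processes M (bank S g y) x"
  unfolding orthogonal_processes_def
proof (intro allI)
  fix s t
  have i: "integrable M (\<lambda>\<omega>. tf_apply (g c) (y c) s \<omega> * x t \<omega>)" if "c \<in> S" for c
    using that assms second_order_tf_apply by (intro l2_mult(1) second_order_l2) auto
  have "(\<integral>\<omega>. bank S g y s \<omega> * x t \<omega> \<partial>M) = (\<Sum>c\<in>S. \<integral>\<omega>. tf_apply (g c) (y c) s \<omega> * x t \<omega> \<partial>M)"
    unfolding bank_def sum_distrib_right using i by (rule Bochner_Integration.integral_sum)
  also have "\<dots> = 0"
  proof (rule sum.neutral, rule ballI)
    fix c assume c: "c \<in> S"
    then have "(\<integral>\<omega>. y c k \<omega> * x t \<omega> \<partial>M) = 0" for k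
      using o by (simp add: orthogonal_processes_def)
    then show "(\<integral>\<omega>. tf_apply (g c) (y c) s \<omega> * x t \<omega> \<partial>M) = 0"
      using integral_tf_apply_mult[OF assms(1,2)[OF c] second_order_l2[OF x], of s t] by simp
  qed
  finally show "(\<integral>\<omega>. bank S g y s \<omega> * x t \<omega> \<partial>M) = 0" .
qed

lemma orthogonal_banks:
  assumes "\<And>s. s \<in> S \<Longrightarrow> g s summable_on UNIV" "\<And>s. s \<in> S \<Longrightarrow> second_order M (y s)"
    and "\<And>s. s \<in> S' \<Longrightarrow> g' s summable_on UNIV" "\<And>s. s \<in> S' \<Longrightarrow> second_order M (y' s)"
    and "\<And>s s'. s \<in> S \<Longrightarrow> s' \<in> S' \<Longrightarrow> orthogonal_processes M (y s) (y' s')"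
  shows "orthogonal_processes M (bank S g y) (bank S' g' y')"
  using assms
  by (intro orthogonal_bank second_order_bank orthogonal_processes_sym[of M "bank S' g' y'"])
     (auto intro: orthogonal_processes_sym)

lemma bank_delta:
  assumes "finite A" "a \<in> A"
  shows "bank A (\<lambda>b. if a = b then delta else (\<lambda>_. 0)) y t \<omega> = y a t \<omega>"
proof -
  have "bank A (\<lambda>b. if a = b then delta else (\<lambda>_. 0)) y t \<omega> = (\<Sum>b\<in>A. if a = b then y b t \<omega> else 0)"
    unfolding bank_def by (intro sum.cong refl) (simp add: tf_apply_conv conv_delta)
  then show ?thesis using assms by simp
qed

text \<open>The part of \<open>y a\<close> that is driven by the innovations in \<open>U\<close> is a filter of the observations
  in \<open>Z\<close> alone: for \<open>b \<in> I'\<close> the sum over \<open>U\<close> equals the one over \<open>A\<close>, an off-diagonal entry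
  of \<open>G T = 1\<close>, and for \<open>b \<in> J'\<close> all its terms vanish.\<close>

lemma innovation_part_filter:
  fixes T G :: "'c::finite \<Rightarrow> 'c \<Rightarrow> tf"
  assumes A: "A = I' \<union> Z \<union> J'" "A = U \<union> V" "U \<inter> V = {}" "Z \<inter> I' = {}" "Z \<inter> J' = {}" "I' \<inter> J' = {}"
    and T: "\<And>a b. T a b summable_on UNIV" and G: "\<And>a b. G a b summable_on UNIV"
    and y: "\<And>a. second_order M (y a)"
    and e: "\<And>c t. c \<in> A \<Longrightarrow> AE \<omega> in M. e c t \<omega> = bank A (T c) y t \<omega>"
    and TU: "\<And>c b. c \<in> U \<Longrightarrow> b \<in> J' \<Longrightarrow> T c b = (\<lambda>_. 0)"
    and TV: "\<And>c b. c \<in> V \<Longrightarrow> b \<in> I' \<Longrightarrow> T c b = (\<lambda>_. 0)"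
    and GT: "\<And>a b. a \<in> A \<Longrightarrow> b \<in> A \<Longrightarrow>
      (\<lambda>k. \<Sum>c\<in>A. conv (G a c) (T c b) k) = (if a = b then delta else (\<lambda>_. 0))"
    and a: "a \<in> Z \<union> J'"
  shows "AE \<omega> in M. bank U (G a) e t \<omega> = bank Z (\<lambda>b k. \<Sum>c\<in>U. conv (G a c) (T c b) k) y t \<omega>"
proof -
  have "AE \<omega> in M. bank U (G a) e t \<omega> = bank U (G a) (\<lambda>c. bank A (T c) y) t \<omega>"
    using e A(2) by (intro bank_cong_AE) auto
  moreover have "AE \<omega> in M. bank U (G a) (\<lambda>c. bank A (T c) y) t \<omega>
      = bank A (\<lambda>b k. \<Sum>c\<in>U. conv (G a c) (T c b) k) y t \<omega>"
    using T G y by (intro bank_bank) auto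
  moreover have "bank A (\<lambda>b k. \<Sum>c\<in>U. conv (G a c) (T c b) k) y
      = bank Z (\<lambda>b k. \<Sum>c\<in>U. conv (G a c) (T c b) k) y"
  proof (rule bank_mono_neutral)
    fix b assume b: "b \<in> A - Z"
    show "(\<lambda>k. \<Sum>c\<in>U. conv (G a c) (T c b) k) = (\<lambda>_. 0)"
    proof (cases "b \<in> J'")
      case True
      then show ?thesis using TU by simp
    next
      case False
      then have bI: "b \<in> I'" using b A by auto
      then have "(\<Sum>c\<in>U. conv (G a c) (T c b) k) = (\<Sum>c\<in>A. conv (G a c) (T c b) k)" for k
        using TV A by (intro sum.mono_neutral_left) auto
      moreover have "a \<noteq> b" "a \<in> A" "b \<in> A" using a bI A by auto
      ultimately show ?thesis using GT[of a b] by simp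
    qed
  qed (use A in auto)
  ultimately show ?thesis by (auto elim: eventually_elim2)
qed

text \<open>Put d = yV a - qV and h = yU a - qU. Then y a - q = d + h, y a - r = d and q - r = - h.
  The cross term has mean zero because d is driven by the innovations in \<open>V\<close> and h by
  those in \<open>U\<close>.\<close>

lemma separation:
  fixes T G :: "'c::finite \<Rightarrow> 'c \<Rightarrow> tf"
  assumes A: "A = I' \<union> Z \<union> J'" "A = U \<union> V" "U \<inter> V = {}" "Z \<inter> I' = {}" "Z \<inter> J' = {}" "I' \<inter> J' = {}"
    and T: "\<And>a b. T a b summable_on UNIV" "\<And>a b. causal (T a b)"
    and G: "\<And>a b. G a b summable_on UNIV" "\<And>a b. causal (G a b)"
    and y: "\<And>a. second_order M (y a)" and e2: "\<And>a. second_order M (e a)"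
    and e: "\<And>c t. c \<in> A \<Longrightarrow> AE \<omega> in M. e c t \<omega> = bank A (T c) y t \<omega>"
    and TU: "\<And>c b. c \<in> U \<Longrightarrow> b \<in> J' \<Longrightarrow> T c b = (\<lambda>_. 0)"
    and TV: "\<And>c b. c \<in> V \<Longrightarrow> b \<in> I' \<Longrightarrow> T c b = (\<lambda>_. 0)"
    and GT: "\<And>a b. a \<in> A \<Longrightarrow> b \<in> A \<Longrightarrow>
      (\<lambda>k. \<Sum>c\<in>A. conv (G a c) (T c b) k) = (if a = b then delta else (\<lambda>_. 0))"
    and orth: "\<And>c d. c \<in> U \<Longrightarrow> d \<in> V \<Longrightarrow> orthogonal_processes M (e c) (e d)"
    and a: "a \<in> J'" and S: "S \<subseteq> I' \<union> Z"
    and W: "\<And>s. s \<in> S \<Longrightarrow> W s summable_on UNIV" "\<And>s. s \<in> S \<Longrightarrow> causal (W s)"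
  shows "\<exists>R. (\<forall>b. R b summable_on UNIV) \<and> (\<forall>b. causal (R b)) \<and>
    (\<forall>t. (\<integral>\<omega>. (y a t \<omega> - bank S W y t \<omega>)\<^sup>2 \<partial>M)
      = (\<integral>\<omega>. (y a t \<omega> - bank Z R y t \<omega>)\<^sup>2 \<partial>M)
        + (\<integral>\<omega>. (bank S W y t \<omega> - bank Z R y t \<omega>)\<^sup>2 \<partial>M))"
proof -
  define FU FV where "FU a b k = (\<Sum>c\<in>U. conv (G a c) (T c b) k)"
    and "FV a b k = (\<Sum>c\<in>V. conv (G a c) (T c b) k)" for a b k
  define yU yV where "yU a = bank U (G a) e" and "yV a = bank V (G a) e" for a
  have FU: "FU a b summable_on UNIV" "causal (FU a b)" for a b
    using summable_on_sum[of U "\<lambda>c. conv (G a c) (T c b)" UNIV] summable_conv[OF G(1) T(1)]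
      causal_conv[OF G(2) T(2)] by (auto simp: FU_def[abs_def] causal_def)
  have FV: "FV a b summable_on UNIV" "causal (FV a b)" for a b
    using summable_on_sum[of V "\<lambda>c. conv (G a c) (T c b)" UNIV] summable_conv[OF G(1) T(1)]
      causal_conv[OF G(2) T(2)] by (auto simp: FV_def[abs_def] causal_def)
  have yU2: "second_order M (yU a)" and yV2: "second_order M (yV a)" for a
    using G e2 by (auto simp: yU_def yV_def intro!: second_order_bank)
  have yU: "AE \<omega> in M. yU b t \<omega> = bank Z (FU b) y t \<omega>" if "b \<in> Z \<union> J'" for b t
    using innovation_part_filter[OF A T(1) G(1) y e TU TV GT that, of t]
    by (simp add: yU_def FU_def[abs_def])
  have yV: "AE \<omega> in M. yV b t \<omega> = bank Z (FV b) y t \<omega>" if "b \<in> Z \<union> I'" for b t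
  proof -
    \<comment> \<open>The hypotheses are symmetric under the simultaneous exchange of
      \<open>I'\<close> with \<open>J'\<close> and of \<open>U\<close> with
      \<open>V\<close>.\<close>
    have A': "A = J' \<union> Z \<union> I'" "A = V \<union> U" "V \<inter> U = {}" "Z \<inter> J' = {}" "Z \<inter> I' = {}" "J' \<inter> I' = {}"
      using A by auto
    show ?thesis
      using innovation_part_filter[OF A' T(1) G(1) y e TV TU GT that, of t]
      by (simp add: yV_def FV_def[abs_def])
  qed
  have split: "AE \<omega> in M. y b t \<omega> = yU b t \<omega> + yV b t \<omega>" if b: "b \<in> A" for b t
  proof -
    have 1: "AE \<omega> in M. yU b t \<omega> = bank U (G b) (\<lambda>c. bank A (T c) y) t \<omega>"
      "AE \<omega> in M. yV b t \<omega> = bank V (G b) (\<lambda>c. bank A (T c) y) t \<omega>"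
      using e A(2) by (auto simp: yU_def yV_def intro!: bank_cong_AE)
    have 2: "AE \<omega> in M. bank U (G b) (\<lambda>c. bank A (T c) y) t \<omega> = bank A (FU b) y t \<omega>"
      "AE \<omega> in M. bank V (G b) (\<lambda>c. bank A (T c) y) t \<omega> = bank A (FV b) y t \<omega>"
      using T G y by (auto simp: FU_def[abs_def] FV_def[abs_def] intro!: bank_bank)
    have 3: "AE \<omega> in M. bank A (\<lambda>c k. FU b c k + FV b c k) y t \<omega> = bank A (FU b) y t \<omega> + bank A (FV b) y t \<omega>"
      using FU FV y by (intro bank_add_filter) auto
    \<comment> \<open>Together the two filters form row \<open>b\<close> of G T, that is, the
      identity filter.\<close>
    have "FU b c k + FV b c k = (\<Sum>d\<in>A. conv (G b d) (T d c) k)" for c k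
      unfolding FU_def FV_def A(2) using A(3) by (simp add: sum.union_disjoint)
    then have "bank A (\<lambda>c k. FU b c k + FV b c k) y = bank A (\<lambda>c. if b = c then delta else (\<lambda>_. 0)) y"
      using GT[OF b] unfolding bank_def by (intro ext sum.cong refl) auto
    then have d: "bank A (\<lambda>c k. FU b c k + FV b c k) y t \<omega> = y b t \<omega>" for \<omega>
      using bank_delta[of A b y t \<omega>] b by simp
    show ?thesis
      using 1 2 3 by eventually_elim (simp add: d)
  qed
  \<comment> \<open>The filter of r = yU a + qV. The first summand exists because \<open>a\<close>
    lies in \<open>J'\<close>; the second substitutes the filters of yV into \<open>W\<close>, which
    is possible because \<open>S\<close> lies in I' \<union> Z.\<close>
  define R where "R b k = FU a b k + (\<Sum>s\<in>S. conv (W s) (FV s b) k)" for b k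
  define qU qV where "qU = bank S W yU" and "qV = bank S W yV"
  have WF: "(\<lambda>k. \<Sum>s\<in>S. conv (W s) (FV s b) k) summable_on UNIV" for b
    using W FV by (intro summable_on_sum summable_conv) auto
  have R: "R b summable_on UNIV" "causal (R b)" for b
    using summable_on_add[OF FU(1) WF] FU(2) causal_conv[OF W(2) FV(2)]
    by (auto simp: R_def[abs_def] causal_def)
  have qU2: "second_order M qU" and qV2: "second_order M qV"
    using W yU2 yV2 by (auto simp: qU_def qV_def intro!: second_order_bank)
  have q: "AE \<omega> in M. bank S W y t \<omega> = qU t \<omega> + qV t \<omega>" for t
  proof -
    have "AE \<omega> in M. bank S W y t \<omega> = bank S W (\<lambda>s t \<omega>. yU s t \<omega> + yV s t \<omega>) t \<omega>"
      using split S A(1) by (intro bank_cong_AE) auto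
    moreover have "AE \<omega> in M. bank S W (\<lambda>s t \<omega>. yU s t \<omega> + yV s t \<omega>) t \<omega> = qU t \<omega> + qV t \<omega>"
      unfolding qU_def qV_def using W yU2 yV2 by (intro bank_add_process) auto
    ultimately show ?thesis by eventually_elim simp
  qed
  have r: "AE \<omega> in M. bank Z R y t \<omega> = yU a t \<omega> + qV t \<omega>" for t
  proof -
    have "AE \<omega> in M. qV t \<omega> = bank S W (\<lambda>s. bank Z (FV s) y) t \<omega>"
      unfolding qV_def using yV S by (intro bank_cong_AE) auto
    moreover have "AE \<omega> in M. bank S W (\<lambda>s. bank Z (FV s) y) t \<omega>
        = bank Z (\<lambda>b k. \<Sum>s\<in>S. conv (W s) (FV s b) k) y t \<omega>"
      using W FV y by (intro bank_bank) auto
    moreover have "AE \<omega> in M. bank Z R y t \<omega>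
        = bank Z (FU a) y t \<omega> + bank Z (\<lambda>b k. \<Sum>s\<in>S. conv (W s) (FV s b) k) y t \<omega>"
      unfolding R_def[abs_def] using FU WF y by (intro bank_add_filter) auto
    moreover have "AE \<omega> in M. yU a t \<omega> = bank Z (FU a) y t \<omega>"
      using yU a by blast
    ultimately show ?thesis by eventually_elim simp
  qed
  have oU: "orthogonal_processes M (yU b) (yV c)" for b c
    unfolding yU_def yV_def using G e2 orth by (intro orthogonal_banks) auto
  have oq: "orthogonal_processes M (yU b) qV" "orthogonal_processes M qU (yV b)" for b
    unfolding qU_def qV_def using W yU2 yV2 oU
    by (auto intro!: orthogonal_processes_sym[OF orthogonal_bank] orthogonal_bank intro: orthogonal_processes_sym)
  have "orthogonal_processes M qU qV"
    using W(1) yU2 qV2 oq(1) unfolding qU_def by (intro orthogonal_bank) auto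
  note oq = oq this
  show ?thesis
  proof (intro exI[of _ R] conjI allI R)
    fix t
    let ?d = "\<lambda>\<omega>. yV a t \<omega> - qV t \<omega>" and ?h = "\<lambda>\<omega>. yU a t \<omega> - qU t \<omega>"
    have l: "l2 M (yU a t)" "l2 M (yV a t)" "l2 M (qU t)" "l2 M (qV t)"
      using yU2 yV2 qU2 qV2 by (simp_all add: second_order_l2)
    have d: "l2 M ?d" and h: "l2 M ?h" using l by (auto intro: l2_diff)
    note ae = split[of a t] q[of t] r[of t]
    have aA: "a \<in> A" using a A(1) by simp
    have m [measurable]: "y a t \<in> borel_measurable M" "bank S W y t \<in> borel_measurable M"
      "bank Z R y t \<in> borel_measurable M" "yU a t \<in> borel_measurable M" "yV a t \<in> borel_measurable M"
      "qU t \<in> borel_measurable M" "qV t \<in> borel_measurable M"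
      using second_order_l2[OF y, of a t] second_order_l2[OF second_order_bank[of S W y], of t]
        second_order_l2[OF second_order_bank[of Z R y], of t] W R y l by (auto simp: l2_def)
    have dh: "(\<integral>\<omega>. ?d \<omega> * ?h \<omega> \<partial>M) = 0"
    proof -
      have "(\<integral>\<omega>. ?d \<omega> * ?h \<omega> \<partial>M) = (\<integral>\<omega>. (yU a t \<omega> * yV a t \<omega> - yU a t \<omega> * qV t \<omega>)
          - (qU t \<omega> * yV a t \<omega> - qU t \<omega> * qV t \<omega>) \<partial>M)"
        by (rule Bochner_Integration.integral_cong) (auto simp: algebra_simps)
      also have "\<dots> = 0"
        using l2_mult(1)[OF l(1,2)] l2_mult(1)[OF l(1,4)] l2_mult(1)[OF l(3,2)] l2_mult(1)[OF l(3,4)] oU oq by (simp add: orthogonal_processes_def)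
      finally show ?thesis .
    qed
    have "(\<integral>\<omega>. (y a t \<omega> - bank S W y t \<omega>)\<^sup>2 \<partial>M) = (\<integral>\<omega>. (?d \<omega>)\<^sup>2 + (?h \<omega>)\<^sup>2 + 2 * (?d \<omega> * ?h \<omega>) \<partial>M)"
    proof (rule integral_cong_AE)
      show "AE \<omega> in M. (y a t \<omega> - bank S W y t \<omega>)\<^sup>2 = (?d \<omega>)\<^sup>2 + (?h \<omega>)\<^sup>2 + 2 * (?d \<omega> * ?h \<omega>)"
        using ae(1)[OF aA] ae(2) by eventually_elim (simp add: power2_eq_square algebra_simps)
    qed simp_all
    also have "\<dots> = (\<integral>\<omega>. (?d \<omega>)\<^sup>2 \<partial>M) + (\<integral>\<omega>. (?h \<omega>)\<^sup>2 \<partial>M)"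
      using d h l2_mult(1)[OF d h] dh by (simp add: l2_def)
    also have "(\<integral>\<omega>. (?d \<omega>)\<^sup>2 \<partial>M) = (\<integral>\<omega>. (y a t \<omega> - bank Z R y t \<omega>)\<^sup>2 \<partial>M)"
    proof (rule integral_cong_AE)
      show "AE \<omega> in M. (?d \<omega>)\<^sup>2 = (y a t \<omega> - bank Z R y t \<omega>)\<^sup>2"
        using ae(1)[OF aA] ae(3) by eventually_elim simp
    qed simp_all
    also have "(\<integral>\<omega>. (?h \<omega>)\<^sup>2 \<partial>M) = (\<integral>\<omega>. (bank S W y t \<omega> - bank Z R y t \<omega>)\<^sup>2 \<partial>M)"
    proof (rule integral_cong_AE)
      show "AE \<omega> in M. (?h \<omega>)\<^sup>2 = (bank S W y t \<omega> - bank Z R y t \<omega>)\<^sup>2"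
        using ae(2,3) by eventually_elim (simp add: power2_commute)
    qed simp_all
    finally show "(\<integral>\<omega>. (y a t \<omega> - bank S W y t \<omega>)\<^sup>2 \<partial>M)
      = (\<integral>\<omega>. (y a t \<omega> - bank Z R y t \<omega>)\<^sup>2 \<partial>M) + (\<integral>\<omega>. (bank S W y t \<omega> - bank Z R y t \<omega>)\<^sup>2 \<partial>M)" .
  qed
qed

end

section \<open>Active walks and d-separation\<close>

definition step :: "('v \<times> 'v) set \<Rightarrow> bool \<Rightarrow> 'v \<Rightarrow> 'v \<Rightarrow> bool" where
  "step E b v w \<longleftrightarrow> (if b then (v, w) \<in> E else (w, v) \<in> E)"

text \<open>\<open>b\<close> is the orientation of the step into \<open>v\<close> and
  \<open>b'\<close> that of the step out of it, so \<open>b \<and> \<not> b'\<close> describes a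
  collider.\<close>

definition passable :: "('v \<times> 'v) set \<Rightarrow> 'v set \<Rightarrow> bool \<Rightarrow> bool \<Rightarrow> 'v \<Rightarrow> bool" where
  "passable E Z b b' v \<longleftrightarrow> (if b \<and> \<not> b' then descendants E v \<inter> Z \<noteq> {} else v \<notin> Z)"

definition active_walk ::
  "('v \<times> 'v) set \<Rightarrow> 'v set \<Rightarrow> 'v set \<Rightarrow> nat \<Rightarrow> (nat \<Rightarrow> 'v) \<Rightarrow> (nat \<Rightarrow> bool) \<Rightarrow> bool" where
  "active_walk E I Z n p d \<longleftrightarrow> p 0 \<in> I \<and> (\<forall>k<n. step E (d k) (p k) (p (Suc k))) \<and>
     (\<forall>k. Suc k < n \<longrightarrow> passable E Z (d k) (d (Suc k)) (p (Suc k)))"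

text \<open>The flag records the orientation of the last step, which decides how the node may be
  left. The initial flag \<open>False\<close> keeps the starting node from counting as a
  collider.\<close>

inductive active_reach :: "('v \<times> 'v) set \<Rightarrow> 'v set \<Rightarrow> 'v set \<Rightarrow> 'v \<Rightarrow> bool \<Rightarrow> bool"
  for E I Z where
  start: "i \<in> I \<Longrightarrow> active_reach E I Z i False"
| move: "active_reach E I Z v h \<Longrightarrow> passable E Z h b v \<Longrightarrow> step E b v w \<Longrightarrow> active_reach E I Z w b"

lemma active_reach_walk:
  assumes "active_reach E I Z v h"
  shows "\<exists>n p d. active_walk E I Z n p d \<and> p n = v \<and> (if n = 0 then \<not> h else d (n - 1) = h)"
  using assms
proof induction
  case (start i)
  then show ?case
    by (intro exI[of _ 0] exI[of _ "\<lambda>_. i"]) (auto simp: active_walk_def)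
next
  case (move v h b w)
  then obtain n p d where
    w: "active_walk E I Z n p d" "p n = v" "if n = 0 then \<not> h else d (n - 1) = h"
    by blast
  have "active_walk E I Z (Suc n) (p(Suc n := w)) (d(n := b))"
    unfolding active_walk_def
  proof (intro conjI allI impI)
    show "(p(Suc n := w)) 0 \<in> I"
      using w(1) by (simp add: active_walk_def)
  next
    fix k assume "k < Suc n"
    then show "step E ((d(n := b)) k) ((p(Suc n := w)) k) ((p(Suc n := w)) (Suc k))"
      using w(1,2) move.hyps by (auto simp: active_walk_def less_Suc_eq)
  next
    fix k assume "Suc k < Suc n"
    then show "passable E Z ((d(n := b)) k) ((d(n := b)) (Suc k)) ((p(Suc n := w)) (Suc k))"
      using w move.hyps by (cases "Suc k = n") (auto simp: active_walk_def)
  qed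
  moreover have "(p(Suc n := w)) (Suc n) = w"
    "if Suc n = 0 then \<not> b else (d(n := b)) (Suc n - 1) = b"
    by simp_all
  ultimately show ?case by blast
qed

text \<open>The walk runs forwards at \<open>i\<close> and backwards at \<open>j\<close>, so it
  turns in between. Its first turn is a collider that is reached from \<open>p i\<close> along
  edges, and passing it requires a descendant in \<open>Z\<close>.\<close>

lemma active_walk_forward_descendant:
  assumes "active_walk E I Z n p d" "i < n" "d i" "j < n" "\<not> d j" "i < j"
  shows "descendants E (p i) \<inter> Z \<noteq> {}"
  using assms(2,3,6)
proof (induction "j - i" arbitrary: i rule: less_induct)
  case less
  have e: "(p i, p (Suc i)) \<in> E"
    using assms(1) less.prems by (auto simp: active_walk_def step_def)
  have "Suc i < n" using assms(4) less.prems by simp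
  then have p: "passable E Z (d i) (d (Suc i)) (p (Suc i))"
    using assms(1) by (simp add: active_walk_def)
  have "descendants E (p (Suc i)) \<inter> Z \<noteq> {}"
  proof (cases "d (Suc i)")
    case True
    then have "i + 1 < j"
      using less.prems assms(5) by (metis Suc_eq_plus1 Suc_lessI)
    then show ?thesis
      using less.hyps[of "Suc i"] True assms(4) by auto
  next
    case False
    then show ?thesis using p less.prems by (auto simp: passable_def)
  qed
  moreover have "descendants E (p (Suc i)) \<subseteq> descendants E (p i)"
    using e by (auto simp: descendants_def intro: converse_rtrancl_into_rtrancl)
  ultimately show ?case by blast
qed

text \<open>Cutting out a loop affects passability only at the junction. If the junction is a
  collider, either \<open>p i\<close> was one at its first visit, or the loop leaves it forwards and
  \<open>active_walk_forward_descendant\<close> applies. If it is not a collider, then neither was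
  one of the two visits, so the node lies outside \<open>Z\<close>.\<close>

lemma active_walk_shortcut:
  assumes w: "active_walk E I Z n p d" and ij: "i < j" "j \<le> n" "p i = p j" and IZ: "I \<inter> Z = {}"
  shows "active_walk E I Z (n - (j - i)) (\<lambda>k. if k \<le> i then p k else p (k + (j - i)))
           (\<lambda>k. if k < i then d k else d (k + (j - i)))"
  unfolding active_walk_def
proof (intro conjI allI impI)
  show "(if 0 \<le> i then p 0 else p (0 + (j - i))) \<in> I"
    using w by (simp add: active_walk_def)
next
  fix k assume k: "k < n - (j - i)"
  have *: "step E (d l) (p l) (p (Suc l))" if "l < n" for l
    using w that by (auto simp: active_walk_def)
  consider "k < i" | "k = i" | "k > i" by linarith
  then show "step E (if k < i then d k else d (k + (j - i)))
     (if k \<le> i then p k else p (k + (j - i))) (if Suc k \<le> i then p (Suc k) else p (Suc k + (j - i)))"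
  proof cases
    case 1 then show ?thesis using *[of k] ij by auto
  next
    case 2 then show ?thesis using *[of "k + (j - i)"] ij k by auto
  next
    case 3 then show ?thesis using *[of "k + (j - i)"] ij k by auto
  qed
next
  fix k assume k: "Suc k < n - (j - i)"
  have *: "passable E Z (d l) (d (Suc l)) (p (Suc l))" if "Suc l < n" for l
    using w that by (auto simp: active_walk_def)
  consider "Suc k < i" | "Suc k = i" | "Suc k > i" by linarith
  then show "passable E Z (if k < i then d k else d (k + (j - i)))
     (if Suc k < i then d (Suc k) else d (Suc k + (j - i)))
     (if Suc k \<le> i then p (Suc k) else p (Suc k + (j - i)))"
  proof cases
    case 1 then show ?thesis using *[of k] ij by auto
  next
    case 3 then show ?thesis using *[of "k + (j - i)"] ij k by auto
  next
    case 2
    then have jn: "j < n" and j0: "Suc (j - 1) = j" using k ij by auto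
    have pi: "passable E Z (d k) (d i) (p i)" using *[of k] 2 ij by auto
    have pj: "passable E Z (d (j - 1)) (d j) (p j)" using *[of "j - 1"] jn j0 by auto
    have "passable E Z (d k) (d j) (p i)"
    proof (cases "d k \<and> \<not> d j")
      case True
      then have "descendants E (p i) \<inter> Z \<noteq> {}"
        using pi active_walk_forward_descendant[OF w _ _ jn, of i] ij jn
        by (cases "d i") (auto simp: passable_def)
      then show ?thesis using True by (simp add: passable_def)
    next
      case False
      then show ?thesis using pi pj ij(3) by (auto simp: passable_def split: if_splits)
    qed
    then show ?thesis using 2 ij by auto
  qed
qed

text \<open>Removing loops shortens the walk, so by induction its nodes may be taken distinct, which
  makes it a path. Inner nodes do not block it because they are passable; the endpoints are never
  colliders and avoid \<open>Z\<close> by disjointness.\<close>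

lemma active_walk_not_dsep:
  assumes w: "active_walk E I Z n p d" and J: "p n \<in> J"
    and disj: "I \<inter> Z = {}" "I \<inter> J = {}" "Z \<inter> J = {}"
  shows "\<not> dsep E I Z J"
  using w J
proof (induction n arbitrary: p d rule: less_induct)
  case (less n)
  note w = less.prems(1)
  have n0: "n \<noteq> 0"
    using less.prems disj by (auto simp: active_walk_def intro!: Nat.gr0I)
  show ?case
  proof (cases "inj_on p {..n}")
    case False
    then obtain i j where ij: "i < j" "j \<le> n" "p i = p j"
      unfolding inj_on_def by (metis atMost_iff linorder_neqE_nat)
    have "p n = (if n - (j - i) \<le> i then p (n - (j - i)) else p (n - (j - i) + (j - i)))"
    proof (cases "n - (j - i) \<le> i")
      case True
      then have "j = n" using ij by auto
      then show ?thesis using ij True by auto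
    qed (use ij in auto)
    then show ?thesis
      using less.IH[OF _ active_walk_shortcut[OF w ij disj(1)]] less.prems(2) ij by auto
  next
    case True
    define ps ds where "ps = map p [0..<Suc n]" and "ds = map d [0..<n]"
    have nth: "ps ! k = p k" if "k \<le> n" for k
      using that by (simp add: ps_def del: upt_Suc)
    have nthd: "ds ! k = d k" if "k < n" for k
      using that by (simp add: ds_def)
    have len: "length ps = Suc n" "length ds = n"
      by (simp_all add: ps_def ds_def)
    have "distinct ps"
      using True by (simp add: ps_def distinct_map atLeast0LessThan lessThan_Suc_atMost del: upt_Suc)
    moreover have "ds \<noteq> []" using n0 by (simp add: ds_def)
    ultimately have path: "is_path E ps ds"
      unfolding is_path_def using w
      by (intro conjI distinct_zipI1) (simp_all add: len nth nthd active_walk_def step_def)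
    have hl: "hd ps = p 0" "last ps = p n"
      by (simp_all add: ps_def hd_map last_map del: upt_Suc)
    have "\<not> blocked E Z ps ds"
    proof -
      have "(collider ds k \<longrightarrow> descendants E (p k) \<inter> Z \<noteq> {}) \<and> (\<not> collider ds k \<longrightarrow> p k \<notin> Z)"
        if k: "k \<le> n" for k
      proof -
        consider "k = 0" | "k = n" | l where "k = Suc l" "Suc l < n"
          using k by (metis le_neq_implies_less not0_implies_Suc)
        then show ?thesis
        proof cases
          case 1
          then show ?thesis using w disj by (auto simp: collider_def active_walk_def)
        next
          case 2
          then show ?thesis using less.prems(2) disj by (auto simp: collider_def len)
        next
          case 3
          then have "passable E Z (d l) (d (Suc l)) (p (Suc l))"
            using w by (auto simp: active_walk_def)
          then show ?thesis using 3 by (auto simp: collider_def len nthd passable_def)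
        qed
      qed
      then show ?thesis unfolding blocked_def len less_Suc_eq_le by (metis nth)
    qed
    moreover have "hd ps \<in> I" "last ps \<in> J"
      using w less.prems by (auto simp: hl active_walk_def)
    ultimately show ?thesis using path by (auto simp: dsep_def)
  qed
qed

text \<open>Every node on the chain lies outside \<open>Z\<close>, and a node that is left forwards
  is never a collider.\<close>

lemma active_reach_descend:
  assumes "(v, w) \<in> E\<^sup>*" "active_reach E I Z v h" "descendants E v \<inter> Z = {}"
  shows "\<exists>h. active_reach E I Z w h"
  using assms
proof (induction arbitrary: h rule: converse_rtrancl_induct)
  case (step v v')
  have "v \<notin> Z" using step.prems by (auto simp: descendants_def)
  then have "active_reach E I Z v' True"
    using step by (intro active_reach.move[OF step.prems(1)]) (auto simp: passable_def step_def)
  moreover have "descendants E v' \<inter> Z = {}"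
    using step.hyps(1) step.prems(2) by (auto simp: descendants_def intro: converse_rtrancl_into_rtrancl)
  ultimately show ?case using step.IH by blast
qed auto

text \<open>The chain is traversed against its edges, starting in \<open>I\<close>. Arriving with
  the flag \<open>False\<close> matters: \<open>v\<close> can then be left in either direction
  without being a collider.\<close>

lemma active_reach_ascend:
  assumes "(v, w) \<in> E\<^sup>*" "w \<in> I" "descendants E v \<inter> Z = {}"
  shows "active_reach E I Z v False"
  using assms
proof (induction rule: converse_rtrancl_induct)
  case base
  then show ?case by (auto intro: active_reach.start)
next
  case (step v v')
  have "descendants E v' \<inter> Z = {}"
    using step.hyps(1) step.prems(2) by (auto simp: descendants_def intro: converse_rtrancl_into_rtrancl)
  then have "active_reach E I Z v' False" and "v' \<notin> Z"
    using step.IH step.prems by (auto simp: descendants_def)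
  then show ?case
    using step.hyps(1) by (auto simp: passable_def step_def intro: active_reach.move[of _ _ _ v' False False])
qed

text \<open>The ancestors \<open>A\<close> of \<open>I \<union> Z \<union> J\<close>, where \<open>I'\<close> consists of the nodes outside \<open>Z\<close> that can be
  reached from \<open>I\<close> by an active walk, and \<open>U\<close> of the nodes whose equation involves \<open>I'\<close>.\<close>

lemma dsep_partition:
  assumes sep: "dsep E I Z J" and disj: "I \<inter> Z = {}" "I \<inter> J = {}" "Z \<inter> J = {}"
  obtains I' J' U V where
    "I \<subseteq> I'" "J \<subseteq> J'" "I' \<inter> Z = {}" "J' \<inter> Z = {}" "I' \<inter> J' = {}" "U \<inter> V = {}"
    "U \<union> V = I' \<union> Z \<union> J'"
    "\<And>v w. v \<in> U \<Longrightarrow> w = v \<or> (w, v) \<in> E \<Longrightarrow> w \<in> I' \<union> Z"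
    "\<And>v w. v \<in> V \<Longrightarrow> w = v \<or> (w, v) \<in> E \<Longrightarrow> w \<in> J' \<union> Z"
proof
  define A where "A = {v. descendants E v \<inter> (I \<union> Z \<union> J) \<noteq> {}}"
  define I' where "I' = {v \<in> A - Z. \<exists>h. active_reach E I Z v h}"
  define J' where "J' = A - Z - I'"
  define U where "U = {v \<in> A. v \<in> I' \<or> (\<exists>w \<in> I'. (w, v) \<in> E)}"
  define V where "V = A - U"
  have nJ: "\<not> active_reach E I Z j h" if "j \<in> J" for j h
    using active_reach_walk[of E I Z j h] active_walk_not_dsep[OF _ _ disj] that sep by metis
  have A: "I \<subseteq> A" "Z \<subseteq> A" "J \<subseteq> A"
    by (auto simp: A_def descendants_def)
  have A_parent: "w \<in> A" if "v \<in> A" "(w, v) \<in> E" for v w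
  proof -
    have "descendants E v \<subseteq> descendants E w"
      using that by (auto simp: descendants_def intro: converse_rtrancl_into_rtrancl)
    then show ?thesis using that by (auto simp: A_def)
  qed
  \<comment> \<open>Reachability spreads to every parent of \<open>v\<close>. A descendant in
    \<open>Z\<close> opens the collider at \<open>v\<close> if the walk entered forwards. Without
    one, \<open>v\<close> still has a descendant in \<open>I\<close> or \<open>J\<close>, being in
    \<open>A\<close>. It is not in \<open>J\<close>, since that would contradict d-separation, so
    \<open>v\<close> can be reached anew from below, with the flag \<open>False\<close>.\<close>
  have turn: "active_reach E I Z w False"
    if v: "v \<in> A" and h: "active_reach E I Z v h" "v \<in> Z \<longrightarrow> h" and w: "(w, v) \<in> E" for v w h
  proof (cases "descendants E v \<inter> Z = {}")
    case False
    then show ?thesis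
      using h w by (intro active_reach.move[OF h(1)]) (auto simp: passable_def step_def)
  next
    case True
    then have "v \<notin> Z" by (auto simp: descendants_def)
    obtain x where x: "x \<in> I \<union> J" "(v, x) \<in> E\<^sup>*"
      using v True by (auto simp: A_def descendants_def)
    have "x \<notin> J"
      using active_reach_descend[OF x(2) h(1) True] nJ by blast
    then have "active_reach E I Z v False"
      using active_reach_ascend[OF x(2) _ True] x by blast
    then show ?thesis
      using \<open>v \<notin> Z\<close> w by (auto simp: passable_def step_def intro: active_reach.move[of _ _ _ v False False])
  qed
  show "I \<subseteq> I'" using A disj by (auto simp: I'_def intro: active_reach.start)
  show "J \<subseteq> J'" using A disj nJ by (auto simp: J'_def I'_def)
  show "I' \<inter> Z = {}" "J' \<inter> Z = {}" "I' \<inter> J' = {}" "U \<inter> V = {}"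
    by (auto simp: I'_def J'_def V_def)
  show "U \<union> V = I' \<union> Z \<union> J'"
    using A by (auto simp: U_def V_def J'_def I'_def)
  show "w \<in> I' \<union> Z" if v: "v \<in> U" and w: "w = v \<or> (w, v) \<in> E" for v w
  proof (cases "w \<in> Z")
    case False
    have vA: "v \<in> A" using v by (simp add: U_def)
    \<comment> \<open>The flag matters for a node of \<open>Z\<close>: entered forwards from a
      parent in \<open>I'\<close>, it is an open collider and leads on to all its parents.\<close>
    have "\<exists>h. active_reach E I Z v h \<and> (v \<in> Z \<longrightarrow> h)"
    proof (cases "v \<in> I'")
      case True
      then show ?thesis by (auto simp: I'_def)
    next
      case False
      then obtain x h where x: "x \<in> A - Z" "active_reach E I Z x h" "(x, v) \<in> E"
        using v by (auto simp: U_def I'_def)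
      then have "active_reach E I Z v True"
        by (intro active_reach.move[OF x(2)]) (auto simp: passable_def step_def)
      then show ?thesis by blast
    qed
    then have "\<exists>h. active_reach E I Z w h"
      using turn[OF vA] w by blast
    then show ?thesis
      using False vA A_parent w by (auto simp: I'_def)
  qed simp
  show "w \<in> J' \<union> Z" if "v \<in> V" "w = v \<or> (w, v) \<in> E" for v w
    using that A_parent by (auto simp: V_def U_def J'_def)
qed

section \<open>Estimation in causal networks\<close>

lemma zero_causal_tf: "(\<lambda>_. 0) \<in> causal_tf_set"
proof -
  have "(\<lambda>_. 0) \<in> tf_set"
    unfolding tf_set_def mem_Collect_eq by (rule exI[of _ 0], rule exI[of _ 1]) simp
  then show ?thesis by (simp add: causal_tf_set_def causal_def)
qed

lemma ctfspan_bank: "q \<in> ctfspan S y \<longleftrightarrow> (\<exists>P. (\<forall>s\<in>S. P s \<in> causal_tf_set) \<and> q = bank S P y)"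
  by (auto simp: ctfspan_def bank_def)

lemma ctfspan_mono:
  assumes "finite S" "Z \<subseteq> S"
  shows "ctfspan Z y \<subseteq> ctfspan S y"
proof
  fix q assume "q \<in> ctfspan Z y"
  then obtain P where P: "\<forall>s\<in>Z. P s \<in> causal_tf_set" "q = bank Z P y"
    by (auto simp: ctfspan_bank)
  have "bank S (\<lambda>s. if s \<in> Z then P s else (\<lambda>_. 0)) y = bank Z (\<lambda>s. if s \<in> Z then P s else (\<lambda>_. 0)) y"
    using assms by (intro bank_mono_neutral) auto
  also have "\<dots> = q" by (simp add: P(2) bank_def)
  finally show "q \<in> ctfspan S y"
    unfolding ctfspan_bank using P(1) zero_causal_tf
    by (intro exI[of _ "\<lambda>s. if s \<in> Z then P s else (\<lambda>_. 0)"]) auto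
qed

text \<open>Rows in \<open>A\<close> have no entries outside \<open>A\<close>, so the block of
  \<open>T ** H\<close> on \<open>A\<close> is the product of the blocks. For square matrices over a
  field a right inverse is also a left inverse.\<close>

lemma submatrix_left_inverse:
  fixes T H :: "complex ^ 'c ^ 'c"
  assumes TH: "T ** H = mat 1" and T0: "\<And>a b. a \<in> A \<Longrightarrow> b \<notin> A \<Longrightarrow> T $ a $ b = 0"
    and ab: "a \<in> A" "b \<in> A"
  shows "(\<Sum>c\<in>A. H $ a $ c * T $ c $ b) = (if a = b then 1 else 0)"
proof -
  \<comment> \<open>Padding a block with the identity keeps the index type, so that the statement on
    one-sided inverses applies to it.\<close>
  define ext where "ext X = (\<chi> a b. if a \<in> A \<and> b \<in> A then X $ a $ b else if a = b then 1 else 0)"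
    for X :: "complex ^ 'c ^ 'c"
  have prod: "(ext X ** ext Y) $ a $ b = (\<Sum>c\<in>A. X $ a $ c * Y $ c $ b)" if "a \<in> A" "b \<in> A" for X Y a b
  proof -
    have "(ext X ** ext Y) $ a $ b = (\<Sum>c\<in>UNIV. ext X $ a $ c * ext Y $ c $ b)"
      by (simp add: matrix_matrix_mult_def)
    also have "\<dots> = (\<Sum>c\<in>A. X $ a $ c * Y $ c $ b)"
    proof (rule sum.mono_neutral_cong_right)
      show "\<forall>c\<in>UNIV - A. ext X $ a $ c * ext Y $ c $ b = 0"
        using that by (auto simp: ext_def)
      show "ext X $ a $ c * ext Y $ c $ b = X $ a $ c * Y $ c $ b" if "c \<in> A" for c
        using that \<open>a \<in> A\<close> \<open>b \<in> A\<close> by (simp add: ext_def)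
    qed simp_all
    finally show ?thesis .
  qed
  have "ext T ** ext H = mat 1"
  proof (intro vec_eq_iff[THEN iffD2] allI)
    fix i j
    show "(ext T ** ext H) $ i $ j = mat 1 $ i $ j"
    proof (cases "i \<in> A \<and> j \<in> A")
      case True
      have "(\<Sum>c\<in>A. T $ i $ c * H $ c $ j) = (\<Sum>c\<in>UNIV. T $ i $ c * H $ c $ j)"
        using T0 True by (intro sum.mono_neutral_left) auto
      also have "\<dots> = mat 1 $ i $ j"
        using TH by (simp add: matrix_matrix_mult_def vec_eq_iff)
      finally show ?thesis using prod True by simp
    next
      case False
      have "(ext T ** ext H) $ i $ j = (\<Sum>c\<in>UNIV. ext T $ i $ c * ext H $ c $ j)"
        by (simp add: matrix_matrix_mult_def)
      also have "\<dots> = (\<Sum>c\<in>UNIV. if c = i then (if i = j then 1 else 0) else 0)"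
      proof (rule sum.cong[OF refl])
        fix c
        have "i \<notin> A \<or> j \<notin> A" using False by blast
        then show "ext T $ i $ c * ext H $ c $ j = (if c = i then (if i = j then 1 else 0) else 0)"
          using T0 by (cases "i \<in> A"; cases "c \<in> A"; cases "c = i"; cases "i = j") (simp_all add: ext_def)
      qed
      finally show ?thesis by (simp add: mat_def)
    qed
  qed
  then have "ext H ** ext T = mat 1"
    by (simp only: matrix_left_right_inverse)
  then show ?thesis
    using prod[OF ab, of H T] by (simp add: mat_def)
qed

context prob_space
begin

section \<open>Correlations, spectral densities and uniqueness of filters\<close>

lemma second_order_stationary:
  assumes "wide_sense_stationary M x"
  shows "second_order M (x a)"
proof -
  have "(\<integral>\<omega>. (x a t \<omega>)\<^sup>2 \<partial>M) = (\<integral>\<omega>. (x a 0 \<omega>)\<^sup>2 \<partial>M)" for t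
  proof -
    have "(\<integral>\<omega>. x a (t + 0) \<omega> * x a t \<omega> \<partial>M) = (\<integral>\<omega>. x a 0 \<omega> * x a 0 \<omega> \<partial>M)"
      using assms unfolding wide_sense_stationary_def by blast
    then show ?thesis by (simp add: power2_eq_square)
  qed
  then have "\<exists>K. \<forall>t. (\<integral>\<omega>. (x a t \<omega>)\<^sup>2 \<partial>M) \<le> K" by (metis order_refl)
  then show ?thesis
    using assms by (simp add: second_order_def l2_def wide_sense_stationary_def)
qed

lemma has_psd_correlation:
  assumes "has_psd M x \<Phi>"
  shows "(\<lambda>s. \<integral>\<omega>. x a s \<omega> * x b 0 \<omega> \<partial>M) summable_on UNIV"
    and "norm z = 1 \<Longrightarrow> zeval (\<lambda>s. \<integral>\<omega>. x a s \<omega> * x b 0 \<omega> \<partial>M) z = \<Phi> z $ a $ b"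
proof -
  let ?R = "\<lambda>s. \<integral>\<omega>. x a s \<omega> * x b 0 \<omega> \<partial>M"
  have h: "((\<lambda>s. of_real (?R s) * z powi (- s)) has_sum (\<Phi> z $ a $ b)) UNIV" if "norm z = 1" for z
    using assms that by (simp add: has_psd_def)
  from h[of 1] have "(\<lambda>s. complex_of_real (?R s)) summable_on UNIV"
    by (simp add: has_sum_imp_summable)
  then have "(\<lambda>s. norm (complex_of_real (?R s))) summable_on UNIV"
    by (simp only: summable_on_iff_abs_summable_on_complex)
  then show "?R summable_on UNIV" by simp
  show "zeval ?R z = \<Phi> z $ a $ b" if "norm z = 1"
    unfolding zeval_def using h[OF that] by (rule infsumI)
qed

text \<open>The transform of the cross-correlation vanishes on the circle, hence so do its
  coefficients; stationarity carries this from time 0 to all times.\<close>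

lemma white_noise_orthogonal:
  assumes "wide_sense_stationary M u" "has_psd M u (\<lambda>_. mat 1)" "a \<noteq> b"
  shows "orthogonal_processes M (u a) (u b)"
  unfolding orthogonal_processes_def
proof (intro allI)
  fix s t
  have "(\<lambda>s. \<integral>\<omega>. u a s \<omega> * u b 0 \<omega> \<partial>M) = (\<lambda>_. 0)"
    using has_psd_correlation[OF assms(2)] assms(3) by (intro zeval_eq_zero_imp) (auto simp: mat_def)
  moreover have "(\<integral>\<omega>. u a (t + (s - t)) \<omega> * u b t \<omega> \<partial>M) = (\<integral>\<omega>. u a (s - t) \<omega> * u b 0 \<omega> \<partial>M)"
    using assms(1) unfolding wide_sense_stationary_def by blast
  ultimately show "(\<integral>\<omega>. u a s \<omega> * u b t \<omega> \<partial>M) = 0"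
    by (simp add: fun_eq_iff)
qed

text \<open>Correlating the zero output with \<open>y b 0\<close> shows that the row of the
  transforms of \<open>g\<close>, multiplied by \<Phi>, vanishes on the circle. With
  \<open>v\<close> the conjugate of that row the Hermitian form is 0, so definiteness forces
  \<open>v = 0\<close>.\<close>

lemma psd_pos_def_filter_unique:
  fixes y :: "'c::finite \<Rightarrow> 'a process"
  assumes y: "\<And>a. second_order M (y a)" and psd: "has_psd M y \<Phi>" and pd: "psd_pos_def_on S \<Phi>"
    and g: "\<And>s. s \<in> S \<Longrightarrow> g s summable_on UNIV"
    and zero: "\<And>t. AE \<omega> in M. bank S g y t \<omega> = 0" and s: "s \<in> S"
  shows "g s = (\<lambda>_. 0)"
proof (rule zeval_eq_zero_imp[OF g[OF s]])
  fix z :: complex assume z: "norm z = 1"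
  define R where "R a b k = (\<integral>\<omega>. y a k \<omega> * y b 0 \<omega> \<partial>M)" for a b k
  have R: "R a b summable_on UNIV" "zeval (R a b) z = \<Phi> z $ a $ b" for a b
    using has_psd_correlation[OF psd] z by (simp_all add: R_def[abs_def])
  have row: "(\<Sum>a\<in>S. zeval (g a) z * \<Phi> z $ a $ b) = 0" for b
  proof -
    have "(\<Sum>a\<in>S. conv (g a) (R a b) t) = 0" for t
    proof -
      have i: "integrable M (\<lambda>\<omega>. tf_apply (g a) (y a) t \<omega> * y b 0 \<omega>)" if "a \<in> S" for a
        using that g y second_order_tf_apply by (intro l2_mult(1) second_order_l2) auto
      have "(\<Sum>a\<in>S. conv (g a) (R a b) t) = (\<Sum>a\<in>S. \<integral>\<omega>. tf_apply (g a) (y a) t \<omega> * y b 0 \<omega> \<partial>M)"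
        using g y by (intro sum.cong refl) (simp add: integral_tf_apply_mult second_order_l2 conv_def R_def)
      also have "\<dots> = (\<integral>\<omega>. bank S g y t \<omega> * y b 0 \<omega> \<partial>M)"
        unfolding bank_def sum_distrib_right using i by (rule Bochner_Integration.integral_sum[symmetric])
      also have "\<dots> = 0"
        using zero[of t] by (intro integral_eq_zero_AE) (auto elim: eventually_mono)
      finally show ?thesis .
    qed
    then have "0 = zeval (\<lambda>t. \<Sum>a\<in>S. conv (g a) (R a b) t) z" by simp
    also have "\<dots> = (\<Sum>a\<in>S. zeval (conv (g a) (R a b)) z)"
      using g R by (intro zeval_sum summable_conv z)
    also have "\<dots> = (\<Sum>a\<in>S. zeval (g a) z * \<Phi> z $ a $ b)"
      using g R z by (intro sum.cong refl) (simp add: zeval_conv)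
    finally show ?thesis by simp
  qed
  define v :: "complex ^ 'c" where "v = (\<chi> a. if a \<in> S then cnj (zeval (g a) z) else 0)"
  have "(\<Sum>a\<in>S. \<Sum>b\<in>S. cnj (v $ a) * \<Phi> z $ a $ b * v $ b)
      = (\<Sum>b\<in>S. (\<Sum>a\<in>S. zeval (g a) z * \<Phi> z $ a $ b) * v $ b)"
    unfolding sum_distrib_right by (subst sum.swap) (intro sum.cong refl, simp add: v_def)
  also have "\<dots> = 0" by (simp add: row)
  finally have "(\<Sum>a\<in>S. \<Sum>b\<in>S. cnj (v $ a) * \<Phi> z $ a $ b * v $ b) = 0" .
  note zero_form = this
  have supp: "\<forall>a. a \<notin> S \<longrightarrow> v $ a = 0" by (simp add: v_def)
  have "v = 0"
  proof (rule ccontr)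
    assume "v \<noteq> 0"
    then have "0 < Re (\<Sum>a\<in>S. \<Sum>b\<in>S. cnj (v $ a) * \<Phi> z $ a $ b * v $ b)"
      using pd z supp unfolding psd_pos_def_on_def by blast
    then show False by (simp only: zero_form zero_complex.sel less_irrefl)
  qed
  then have "v $ s = 0" by simp
  then show "zeval (g s) z = 0" using s by (simp add: v_def)
qed

text \<open>One factor \<open>card Z\<close> comes from Cauchy-Schwarz over \<open>Z\<close>, the
  other from adding up the bounds of the single filters.\<close>

lemma bank_second_moment:
  assumes "finite Z" and g: "\<And>b. b \<in> Z \<Longrightarrow> g b summable_on UNIV" "\<And>b. b \<in> Z \<Longrightarrow> (\<Sum>\<^sub>\<infinity>k. \<bar>g b k\<bar>) \<le> \<eta>"
    and y: "\<And>b. second_order M (y b)" and K: "\<And>b t. b \<in> Z \<Longrightarrow> (\<integral>\<omega>. (y b t \<omega>)\<^sup>2 \<partial>M) \<le> K"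
  shows "(\<integral>\<omega>. (bank Z g y t \<omega>)\<^sup>2 \<partial>M) \<le> (real (card Z))\<^sup>2 * (\<eta>\<^sup>2 * K)"
proof -
  have l: "l2 M (tf_apply (g b) (y b) t)" and m: "(\<integral>\<omega>. (tf_apply (g b) (y b) t \<omega>)\<^sup>2 \<partial>M) \<le> \<eta>\<^sup>2 * K" if b: "b \<in> Z" for b
  proof -
    note * = tf_apply_second_moment[OF g(1)[OF b] y K[OF b]]
    show "l2 M (tf_apply (g b) (y b) t)" by (rule *)
    have "K \<ge> 0" using K[OF b, of 0] by (rule order_trans[rotated]) simp
    moreover have "0 \<le> (\<Sum>\<^sub>\<infinity>k. \<bar>g b k\<bar>)" by (intro infsum_nonneg) simp
    ultimately have "(\<Sum>\<^sub>\<infinity>k. \<bar>g b k\<bar>)\<^sup>2 * K \<le> \<eta>\<^sup>2 * K"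
      using g(2)[OF b] by (intro mult_right_mono power_mono)
    with *(2)[of t] show "(\<integral>\<omega>. (tf_apply (g b) (y b) t \<omega>)\<^sup>2 \<partial>M) \<le> \<eta>\<^sup>2 * K" by linarith
  qed
  have i: "integrable M (\<lambda>\<omega>. real (card Z) * (\<Sum>b\<in>Z. (tf_apply (g b) (y b) t \<omega>)\<^sup>2))"
    using l by (auto simp: l2_def)
  have "(\<integral>\<omega>. (bank Z g y t \<omega>)\<^sup>2 \<partial>M) \<le> (\<integral>\<omega>. real (card Z) * (\<Sum>b\<in>Z. (tf_apply (g b) (y b) t \<omega>)\<^sup>2) \<partial>M)"
  proof (rule integral_mono[OF _ i])
    show "integrable M (\<lambda>\<omega>. (bank Z g y t \<omega>)\<^sup>2)"
      using second_order_l2[OF second_order_bank[of Z g y], of t] g(1) y by (simp add: l2_def)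
    show "(bank Z g y t \<omega>)\<^sup>2 \<le> real (card Z) * (\<Sum>b\<in>Z. (tf_apply (g b) (y b) t \<omega>)\<^sup>2)" for \<omega>
      unfolding bank_def using Cauchy_Schwarz_ineq_sum[of "\<lambda>_. 1" "\<lambda>b. tf_apply (g b) (y b) t \<omega>" Z] by simp
  qed
  also have "\<dots> = real (card Z) * (\<Sum>b\<in>Z. \<integral>\<omega>. (tf_apply (g b) (y b) t \<omega>)\<^sup>2 \<partial>M)"
    using l by (simp add: l2_def Bochner_Integration.integral_sum)
  also have "\<dots> \<le> real (card Z) * (\<Sum>b\<in>Z. \<eta>\<^sup>2 * K)"
    by (intro mult_left_mono sum_mono m) simp_all
  finally show ?thesis by (simp add: power2_eq_square mult_ac)
qed

text \<open>The change of the filters enters the squared error through a cross term as well. The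
  inequality (a + b)^2 <= (1 + \<delta>) a^2 + (1 + 1 / \<delta>) b^2 absorbs it, with bounds that
  are uniform in \<open>t\<close>.\<close>

lemma bank_rational_approximation:
  fixes y :: "'c::finite \<Rightarrow> 'a process"
  assumes R: "\<And>b. R b summable_on UNIV" "\<And>b. causal (R b)"
    and y: "\<And>b. second_order M (y b)" and x: "second_order M x" and \<epsilon>: "\<epsilon> > 0"
  obtains r where "r \<in> ctfspan Z y"
    "\<And>t. (\<integral>\<omega>. (x t \<omega> - r t \<omega>)\<^sup>2 \<partial>M) \<le> (\<integral>\<omega>. (x t \<omega> - bank Z R y t \<omega>)\<^sup>2 \<partial>M) + \<epsilon>"
proof -
  have d2: "second_order M (\<lambda>t \<omega>. x t \<omega> - bank Z R y t \<omega>)"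
  proof -
    \<comment> \<open>The difference is written as one bank over the option type, with
      \<open>x\<close> at the index \<open>None\<close>, so that \<open>second_order_bank\<close>
      covers it.\<close>
    have "second_order M (bank (insert None (Some ` Z)) (\<lambda>b. case b of None \<Rightarrow> delta | Some b \<Rightarrow> (\<lambda>k. - R b k))
        (\<lambda>b. case b of None \<Rightarrow> x | Some b \<Rightarrow> y b))"
      using R x y summable_delta by (intro second_order_bank) (auto simp: summable_on_uminus)
    also have "bank (insert None (Some ` Z)) (\<lambda>b. case b of None \<Rightarrow> delta | Some b \<Rightarrow> (\<lambda>k. - R b k))
        (\<lambda>b. case b of None \<Rightarrow> x | Some b \<Rightarrow> y b) = (\<lambda>t \<omega>. x t \<omega> - bank Z R y t \<omega>)"
    proof -
      have "conv (\<lambda>k. - p k) w t = - conv p w t" for p w :: "int \<Rightarrow> real" and t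
        by (simp add: conv_def infsum_uminus)
      then show ?thesis
        by (simp add: bank_def fun_eq_iff sum.reindex tf_apply_conv conv_delta sum_negf)
    qed
    finally show ?thesis .
  qed
  obtain D where D: "\<And>t. (\<integral>\<omega>. (x t \<omega> - bank Z R y t \<omega>)\<^sup>2 \<partial>M) \<le> D"
    using d2 by (auto simp: second_order_def)
  have "\<forall>b. \<exists>K. \<forall>t. (\<integral>\<omega>. (y b t \<omega>)\<^sup>2 \<partial>M) \<le> K"
    using y by (simp add: second_order_def)
  then obtain Kf where Kf: "\<And>b t. (\<integral>\<omega>. (y b t \<omega>)\<^sup>2 \<partial>M) \<le> Kf b" by metis
  define K where "K = (\<Sum>b\<in>UNIV. \<bar>Kf b\<bar>)"
  have K: "(\<integral>\<omega>. (y b t \<omega>)\<^sup>2 \<partial>M) \<le> K" for b t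
  proof -
    have "(\<integral>\<omega>. (y b t \<omega>)\<^sup>2 \<partial>M) \<le> \<bar>Kf b\<bar>" using Kf order_trans[OF _ abs_ge_self] by blast
    also have "\<dots> \<le> K" unfolding K_def by (rule member_le_sum) auto
    finally show ?thesis .
  qed
  have K0: "K \<ge> 0" by (simp add: K_def sum_nonneg)
  have D0: "D \<ge> 0" using D[of 0] by (rule order_trans[rotated]) simp
  \<comment> \<open>Half of \<epsilon> is reserved for the enlargement of the original error, which
    is at most \<open>D\<close>; \<open>D + 1\<close> keeps the denominator positive.\<close>
  define \<delta> where "\<delta> = \<epsilon> / (2 * (D + 1))"
  have \<delta>: "\<delta> > 0" "\<delta> * D \<le> \<epsilon> / 2" using \<epsilon> D0 by (simp_all add: \<delta>_def field_simps)
  \<comment> \<open>\<open>B\<close> bounds the factor of \<eta>^2 in the perturbation term, and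
    \<eta> is chosen to make this term at most \<epsilon> / 2. The added 1 keeps \<open>B\<close>
    positive when \<open>Z\<close> is empty or \<open>K = 0\<close>.\<close>
  define B where "B = (1 + 1 / \<delta>) * ((real (card Z))\<^sup>2 * K) + 1"
  have B: "B > 0" "(1 + 1 / \<delta>) * ((real (card Z))\<^sup>2 * K) \<le> B"
    using \<delta> K0 by (auto simp: B_def intro!: add_nonneg_pos mult_nonneg_nonneg)
  define \<eta> where "\<eta> = sqrt (\<epsilon> / (2 * B))"
  have \<eta>: "\<eta> > 0" "\<eta>\<^sup>2 * B = \<epsilon> / 2" using \<epsilon> B by (simp_all add: \<eta>_def)
  have "\<forall>b. \<exists>p'. p' \<in> causal_tf_set \<and> (\<Sum>\<^sub>\<infinity>k. \<bar>R b k - p' k\<bar>) \<le> \<eta>"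
    using causal_tf_approximation[OF R \<eta>(1)] by metis
  then obtain R' where R': "\<And>b. R' b \<in> causal_tf_set" "\<And>b. (\<Sum>\<^sub>\<infinity>k. \<bar>R b k - R' b k\<bar>) \<le> \<eta>" by metis
  have R's: "R' b summable_on UNIV" for b
    using R'(1)[of b] tf_set_summable by (auto simp: causal_tf_set_def)
  define h where "h = bank Z (\<lambda>b k. R b k - R' b k) y"
  have h2: "second_order M h"
    unfolding h_def using R R's y by (intro second_order_bank summable_on_diff)
  show thesis
  proof (rule that)
    show "bank Z R' y \<in> ctfspan Z y" unfolding ctfspan_bank using R'(1) by (intro exI[of _ R']) simp
    fix t
    let ?d = "\<lambda>\<omega>. x t \<omega> - bank Z R y t \<omega>"
    have dl: "l2 M ?d" and hl: "l2 M (h t)" using d2 h2 by (simp_all add: second_order_def)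
    have R'l: "l2 M (\<lambda>\<omega>. x t \<omega> - bank Z R' y t \<omega>)"
      using x R's y by (intro l2_diff second_order_l2 second_order_bank)
    have hb: "(\<integral>\<omega>. (h t \<omega>)\<^sup>2 \<partial>M) \<le> (real (card Z))\<^sup>2 * (\<eta>\<^sup>2 * K)"
      unfolding h_def using R R's R'(2) y K by (intro bank_second_moment summable_on_diff) auto
    have ineq: "(a + b)\<^sup>2 \<le> (1 + \<delta>) * a\<^sup>2 + (1 + 1 / \<delta>) * b\<^sup>2" for a b :: real
    proof -
      have "0 \<le> (\<delta> * a - b)\<^sup>2 / \<delta>" using \<delta> by simp
      also have "\<dots> = \<delta> * a\<^sup>2 - 2 * a * b + 1 / \<delta> * b\<^sup>2"
        using \<delta> by (simp add: power2_eq_square field_simps)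
      finally show ?thesis by (simp add: power2_sum algebra_simps)
    qed
    have ae: "AE \<omega> in M. (x t \<omega> - bank Z R' y t \<omega>)\<^sup>2 \<le> (1 + \<delta>) * (?d \<omega>)\<^sup>2 + (1 + 1 / \<delta>) * (h t \<omega>)\<^sup>2"
    proof -
      have "AE \<omega> in M. h t \<omega> = bank Z R y t \<omega> - bank Z R' y t \<omega>"
        unfolding h_def using R R's y by (intro bank_diff_filter) auto
      then show ?thesis
      proof eventually_elim
        case (elim \<omega>)
        show ?case using ineq[of "?d \<omega>" "h t \<omega>"] by (simp add: elim)
      qed
    qed
    have "(\<integral>\<omega>. (x t \<omega> - bank Z R' y t \<omega>)\<^sup>2 \<partial>M) \<le> (\<integral>\<omega>. (1 + \<delta>) * (?d \<omega>)\<^sup>2 + (1 + 1 / \<delta>) * (h t \<omega>)\<^sup>2 \<partial>M)"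
      using R'l dl hl ae by (intro integral_mono_AE) (auto simp: l2_def)
    also have "\<dots> = (1 + \<delta>) * (\<integral>\<omega>. (?d \<omega>)\<^sup>2 \<partial>M) + (1 + 1 / \<delta>) * (\<integral>\<omega>. (h t \<omega>)\<^sup>2 \<partial>M)"
      using dl hl by (simp add: l2_def)
    also have "(1 + 1 / \<delta>) * (\<integral>\<omega>. (h t \<omega>)\<^sup>2 \<partial>M) \<le> (1 + 1 / \<delta>) * ((real (card Z))\<^sup>2 * (\<eta>\<^sup>2 * K))"
      using hb \<delta> by (intro mult_left_mono) auto
    also have "\<dots> = \<eta>\<^sup>2 * ((1 + 1 / \<delta>) * ((real (card Z))\<^sup>2 * K))" by (simp add: mult_ac)
    also have "\<dots> \<le> \<epsilon> / 2"
      unfolding \<eta>(2)[symmetric] using B by (intro mult_left_mono) auto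
    also have "(1 + \<delta>) * (\<integral>\<omega>. (?d \<omega>)\<^sup>2 \<partial>M) \<le> (\<integral>\<omega>. (?d \<omega>)\<^sup>2 \<partial>M) + \<epsilon> / 2"
    proof -
      have "\<delta> * (\<integral>\<omega>. (?d \<omega>)\<^sup>2 \<partial>M) \<le> \<delta> * D" using D[of t] \<delta>(1) by (intro mult_left_mono) auto
      with \<delta>(2) show ?thesis by (simp add: distrib_right)
    qed
    finally show "(\<integral>\<omega>. (x t \<omega> - bank Z R' y t \<omega>)\<^sup>2 \<partial>M) \<le> (\<integral>\<omega>. (?d \<omega>)\<^sup>2 \<partial>M) + \<epsilon>"
      by simp
  qed
qed

text \<open>The partition of the nodes is pulled back along \<nu> to the scalar components, and the
  global causal inverse \<open>H\<close> serves as the inverse on the ancestors.\<close>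

lemma ldim_separation:
  fixes \<nu> :: "'c::finite \<Rightarrow> 'v::finite" and \<mu> :: "'d::finite \<Rightarrow> 'v" and Q :: "'c \<Rightarrow> 'c \<Rightarrow> tf"
  assumes ldim: "ldim M \<nu> \<mu> Q P u e y" and graph: "graphical_representation E \<nu> Q"
    and disj: "I \<inter> Z = {}" "I \<inter> J = {}" "Z \<inter> J = {}"
    and causal: "causal_ldim Q" and stable: "causally_stable Q" and sep: "dsep E I Z J"
    and a: "\<nu> a \<in> J"
    and W: "\<And>s. \<nu> s \<in> I \<union> Z \<Longrightarrow> W s summable_on UNIV" "\<And>s. \<nu> s \<in> I \<union> Z \<Longrightarrow> causal (W s)"
  shows "\<exists>R. (\<forall>b. R b summable_on UNIV) \<and> (\<forall>b. causal (R b)) \<and>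
    (\<forall>t. (\<integral>\<omega>. (y a t \<omega> - bank (\<nu> -` (I \<union> Z)) W y t \<omega>)\<^sup>2 \<partial>M)
      = (\<integral>\<omega>. (y a t \<omega> - bank (\<nu> -` Z) R y t \<omega>)\<^sup>2 \<partial>M)
        + (\<integral>\<omega>. (bank (\<nu> -` (I \<union> Z)) W y t \<omega> - bank (\<nu> -` Z) R y t \<omega>)\<^sup>2 \<partial>M))"
proof -
  have Qs: "Q a b summable_on UNIV" and Qc: "causal (Q a b)" for a b
    using ldim causal by (auto simp: ldim_def causal_ldim_def intro: tf_set_summable)
  have Ps: "P a c summable_on UNIV" and P0: "\<nu> a \<noteq> \<mu> c \<Longrightarrow> P a c = (\<lambda>_. 0)" for a c
    using ldim tf_set_summable by (auto simp: ldim_def causal_tf_set_def)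
  have u: "wide_sense_stationary M u" "has_psd M u (\<lambda>_. mat 1)" and y: "wide_sense_stationary M y"
    and e: "AE \<omega> in M. e a t \<omega> = (\<Sum>c\<in>UNIV. tf_apply (P a c) (u c) t \<omega>)"
    and yQ: "AE \<omega> in M. y a t \<omega> = (\<Sum>b\<in>UNIV. tf_apply (Q a b) (y b) t \<omega>) + e a t \<omega>" for a t
    using ldim unfolding ldim_def by blast+
  note y2 = second_order_stationary[OF y] and u2 = second_order_stationary[OF u(1)]
  obtain H where Hc: "\<And>a b. causal (H a b)" and Hs: "\<And>a b. H a b summable_on UNIV"
    and H: "\<And>z. norm z = 1 \<Longrightarrow> (mat 1 - zeval_matrix Q z) ** zeval_matrix H z = mat 1"
    using stable by (auto simp: causally_stable_def)

  define \<Delta> where "\<Delta> a b = (if a = b then delta else (\<lambda>_. 0))" for a b :: 'c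
  have \<Delta>: "\<Delta> a b summable_on UNIV" "causal (\<Delta> a b)" for a b
    using summable_delta causal_delta by (auto simp: \<Delta>_def causal_def)
  define T where "T a b = (\<lambda>k. \<Delta> a b k - Q a b k)" for a b
  have Ts: "T a b summable_on UNIV" and Tc: "causal (T a b)" for a b
    using summable_on_diff[OF \<Delta>(1) Qs] \<Delta>(2)[of a b] Qc[of a b] by (auto simp: T_def causal_def)
  have Tz: "zeval (T a b) z = (mat 1 - zeval_matrix Q z) $ a $ b" if "norm z = 1" for a b z
    unfolding T_def zeval_diff[OF \<Delta>(1) Qs that]
    by (simp add: zeval_matrix_def mat_def \<Delta>_def zeval_delta)
  have T0: "T a b = (\<lambda>_. 0)" if "\<not> (\<nu> b = \<nu> a \<or> (\<nu> b, \<nu> a) \<in> E)" for a b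
  proof -
    have "Q a b = (\<lambda>_. 0)" using graph that by (auto simp: graphical_representation_def)
    moreover have "a \<noteq> b" using that by auto
    ultimately show ?thesis by (simp add: T_def \<Delta>_def)
  qed

  obtain I' J' U V where part: "I \<subseteq> I'" "J \<subseteq> J'" "I' \<inter> Z = {}" "J' \<inter> Z = {}" "I' \<inter> J' = {}" "U \<inter> V = {}"
    "U \<union> V = I' \<union> Z \<union> J'"
    and U: "\<And>v w. v \<in> U \<Longrightarrow> w = v \<or> (w, v) \<in> E \<Longrightarrow> w \<in> I' \<union> Z"
    and V: "\<And>v w. v \<in> V \<Longrightarrow> w = v \<or> (w, v) \<in> E \<Longrightarrow> w \<in> J' \<union> Z"
    using dsep_partition[OF sep disj] by blast
  define A where "A = \<nu> -` (I' \<union> Z \<union> J')"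
  have A: "A = \<nu> -` I' \<union> \<nu> -` Z \<union> \<nu> -` J'" "A = \<nu> -` U \<union> \<nu> -` V" "\<nu> -` U \<inter> \<nu> -` V = {}"
    "\<nu> -` Z \<inter> \<nu> -` I' = {}" "\<nu> -` Z \<inter> \<nu> -` J' = {}" "\<nu> -` I' \<inter> \<nu> -` J' = {}"
    using part(3-7) unfolding A_def by (blast, simp only: vimage_Un[symmetric], blast+)
  have TU: "T c b = (\<lambda>_. 0)" if "c \<in> \<nu> -` U" "b \<in> \<nu> -` J'" for c b
    using U[of "\<nu> c" "\<nu> b"] part that by (intro T0) blast
  have TV: "T c b = (\<lambda>_. 0)" if "c \<in> \<nu> -` V" "b \<in> \<nu> -` I'" for c b
    using V[of "\<nu> c" "\<nu> b"] part that by (intro T0) blast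
  have TA: "T c b = (\<lambda>_. 0)" if "c \<in> A" "b \<notin> A" for c b
    using U[of "\<nu> c" "\<nu> b"] V[of "\<nu> c" "\<nu> b"] that A(1,2) by (intro T0) blast

  \<comment> \<open>Invertibility is known on the circle only; uniqueness of the coefficients turns
    the block identity there into an identity of filters.\<close>
  have HT: "(\<lambda>k. \<Sum>c\<in>A. conv (H a c) (T c b) k) = (if a = b then delta else (\<lambda>_. 0))"
    if ab: "a \<in> A" "b \<in> A" for a b
  proof (rule zeval_inject)
    show "(\<lambda>k. \<Sum>c\<in>A. conv (H a c) (T c b) k) summable_on UNIV"
      using Hs Ts by (intro summable_on_sum summable_conv)
    show "(if a = b then delta else (\<lambda>_. 0)) summable_on UNIV"
      using \<Delta>(1)[of a b] by (simp add: \<Delta>_def)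
    fix z :: complex assume z: "norm z = 1"
    have "zeval (\<lambda>k. \<Sum>c\<in>A. conv (H a c) (T c b) k) z = (\<Sum>c\<in>A. zeval (conv (H a c) (T c b)) z)"
      using Hs Ts by (intro zeval_sum summable_conv z)
    also have "\<dots> = (\<Sum>c\<in>A. zeval_matrix H z $ a $ c * (mat 1 - zeval_matrix Q z) $ c $ b)"
      using Hs Ts z by (intro sum.cong refl) (simp add: zeval_conv Tz zeval_matrix_def)
    also have "\<dots> = (if a = b then 1 else 0)"
    proof (rule submatrix_left_inverse[OF H[OF z] _ ab])
      show "(mat 1 - zeval_matrix Q z) $ a $ b = 0" if "a \<in> A" "b \<notin> A" for a b
        using TA[OF that] Tz[OF z, of a b] by simp
    qed
    finally show "zeval (\<lambda>k. \<Sum>c\<in>A. conv (H a c) (T c b) k) z = zeval (if a = b then delta else (\<lambda>_. 0)) z"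
      by (simp add: zeval_delta)
  qed

  text \<open>Nothing is assumed about the measurability of \<open>e\<close> itself.\<close>
  define e' where "e' a = bank UNIV (P a) u" for a
  have e'2: "second_order M (e' a)" for a
    unfolding e'_def using Ps u2 by (intro second_order_bank)
  have e'T: "AE \<omega> in M. e' c t \<omega> = bank A (T c) y t \<omega>" if c: "c \<in> A" for c t
  proof -
    have "bank UNIV (T c) y = bank A (T c) y"
      using TA c by (intro bank_mono_neutral) auto
    moreover have "AE \<omega> in M. bank UNIV (T c) y t \<omega> = bank UNIV (\<Delta> c) y t \<omega> - bank UNIV (Q c) y t \<omega>"
      unfolding T_def using \<Delta> Qs y2 by (intro bank_diff_filter) auto
    moreover have "bank UNIV (\<Delta> c) y t \<omega> = y c t \<omega>" for \<omega>
      unfolding \<Delta>_def by (rule bank_delta) auto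
    ultimately show ?thesis
      using e[of c t] yQ[of c t] by (auto elim!: eventually_elim2 simp: e'_def bank_def[of UNIV])
  qed
  have orth: "orthogonal_processes M (e' c) (e' d)" if cd: "c \<in> \<nu> -` U" "d \<in> \<nu> -` V" for c d
  proof -
    \<comment> \<open>As \<open>P\<close> is block diagonal, the innovation of a component uses only
      the inputs of its own node. Nodes in \<open>U\<close> and in \<open>V\<close> therefore use
      different inputs, which are uncorrelated.\<close>
    have e'_eq: "e' c = bank (\<mu> -` {\<nu> c}) (P c) u" for c
      unfolding e'_def using P0 by (intro bank_mono_neutral) auto
    show ?thesis
      unfolding e'_eq
    proof (rule orthogonal_banks)
      fix i j assume "i \<in> \<mu> -` {\<nu> c}" "j \<in> \<mu> -` {\<nu> d}"
      then have "i \<noteq> j" using cd part(6) by auto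
      then show "orthogonal_processes M (u i) (u j)"
        by (rule white_noise_orthogonal[OF u])
    qed (use Ps u2 in auto)
  qed
  have aJ: "a \<in> \<nu> -` J'" using a part(2) by auto
  have S: "\<nu> -` (I \<union> Z) \<subseteq> \<nu> -` I' \<union> \<nu> -` Z" using part(1) by auto
  have W': "W s summable_on UNIV" "causal (W s)" if "s \<in> \<nu> -` (I \<union> Z)" for s
    using W that by auto
  show ?thesis
    by (rule separation[where A=A and I'="\<nu> -` I'" and J'="\<nu> -` J'" and U="\<nu> -` U" and V="\<nu> -` V"
          and T=T and G=H and e=e'];
        fact A Ts Tc Hs Hc y2 e'2 e'T TU TV HT orth aJ S W')
qed

section \<open>Mean-square errors of vector-valued estimates and the conclusion\<close>

lemma mse_eq_sum:
  assumes "\<And>a. a \<in> A \<Longrightarrow> l2 M (x a t)" "\<And>a. a \<in> A \<Longrightarrow> l2 M (q a t)"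
  shows "mse M A x q t = (\<Sum>a\<in>A. \<integral>\<omega>. (x a t \<omega> - q a t \<omega>)\<^sup>2 \<partial>M)"
  unfolding mse_def
proof (rule Bochner_Integration.integral_sum)
  show "integrable M (\<lambda>\<omega>. (x a t \<omega> - q a t \<omega>)\<^sup>2)" if "a \<in> A" for a
    using l2_diff[OF assms(1)[OF that] assms(2)[OF that]] by (simp add: l2_def)
qed

lemma second_order_ctfspan:
  assumes "\<And>a. second_order M (y a)" "q \<in> ctfspan S y"
  shows "second_order M q"
proof -
  obtain P where "\<forall>s\<in>S. P s \<in> causal_tf_set" "q = bank S P y"
    using assms(2) by (auto simp: ctfspan_bank)
  then show ?thesis
    using assms(1) tf_set_summable by (auto simp: causal_tf_set_def intro!: second_order_bank)
qed

text \<open>The estimates \<open>bank Z (R a) y\<close> need not belong to \<^const>\<open>ctfspan\<close>, because \<^const>\<open>tf_set\<close> is not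
  closed under addition.\<close>

lemma mse_rational_approximation:
  fixes y :: "'c::finite \<Rightarrow> 'a process"
  assumes y: "\<And>a. second_order M (y a)"
    and R: "\<And>a b. R a b summable_on UNIV" "\<And>a b. causal (R a b)"
    and q: "\<forall>a\<in>A. second_order M (q a)"
    and pyth: "\<forall>a\<in>A. \<forall>t. (\<integral>\<omega>. (y a t \<omega> - q a t \<omega>)\<^sup>2 \<partial>M)
      = (\<integral>\<omega>. (y a t \<omega> - bank Z (R a) y t \<omega>)\<^sup>2 \<partial>M) + (\<integral>\<omega>. (q a t \<omega> - bank Z (R a) y t \<omega>)\<^sup>2 \<partial>M)"
    and \<epsilon>: "\<epsilon> > 0"
  obtains r where "\<And>a. r a \<in> ctfspan Z y"
    "\<And>t. mse M A y r t + (\<Sum>a\<in>A. \<integral>\<omega>. (q a t \<omega> - bank Z (R a) y t \<omega>)\<^sup>2 \<partial>M) \<le> mse M A y q t + \<epsilon>"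
proof -
  \<comment> \<open>The tolerance is shared among the components in \<open>A\<close>; adding 1
    covers the case of empty \<open>A\<close>.\<close>
  define \<delta> where "\<delta> = \<epsilon> / (real (card A) + 1)"
  have \<delta>: "\<delta> > 0" "real (card A) * \<delta> \<le> \<epsilon>"
    using \<epsilon> by (simp_all add: \<delta>_def field_simps)
  have "\<forall>a. \<exists>r. r \<in> ctfspan Z y \<and> (\<forall>t. (\<integral>\<omega>. (y a t \<omega> - r t \<omega>)\<^sup>2 \<partial>M)
      \<le> (\<integral>\<omega>. (y a t \<omega> - bank Z (R a) y t \<omega>)\<^sup>2 \<partial>M) + \<delta>)"
  proof
    fix a
    show "\<exists>r. r \<in> ctfspan Z y \<and> (\<forall>t. (\<integral>\<omega>. (y a t \<omega> - r t \<omega>)\<^sup>2 \<partial>M)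
        \<le> (\<integral>\<omega>. (y a t \<omega> - bank Z (R a) y t \<omega>)\<^sup>2 \<partial>M) + \<delta>)"
      by (rule bank_rational_approximation[where x="y a" and R="R a" and y=y and Z=Z and \<epsilon>=\<delta>, OF R y y \<delta>(1)]) blast
  qed
  from choice[OF this] obtain r where r: "\<And>a. r a \<in> ctfspan Z y"
    "\<And>a t. (\<integral>\<omega>. (y a t \<omega> - r a t \<omega>)\<^sup>2 \<partial>M) \<le> (\<integral>\<omega>. (y a t \<omega> - bank Z (R a) y t \<omega>)\<^sup>2 \<partial>M) + \<delta>"
    by blast
  have l: "l2 M (y a t)" "l2 M (r a t)" "a \<in> A \<Longrightarrow> l2 M (q a t)" for a t
    using y q second_order_ctfspan[OF y r(1)] by (simp_all add: second_order_l2)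
  show thesis
  proof (rule that[OF r(1)])
    fix t
    have "mse M A y r t \<le> (\<Sum>a\<in>A. (\<integral>\<omega>. (y a t \<omega> - bank Z (R a) y t \<omega>)\<^sup>2 \<partial>M) + \<delta>)"
      using l by (subst mse_eq_sum) (auto intro!: sum_mono r(2))
    also have "\<dots> \<le> (\<Sum>a\<in>A. \<integral>\<omega>. (y a t \<omega> - bank Z (R a) y t \<omega>)\<^sup>2 \<partial>M) + \<epsilon>"
      using \<delta>(2) by (simp add: sum.distrib)
    finally have "mse M A y r t \<le> (\<Sum>a\<in>A. \<integral>\<omega>. (y a t \<omega> - bank Z (R a) y t \<omega>)\<^sup>2 \<partial>M) + \<epsilon>" .
    moreover have "mse M A y q t = (\<Sum>a\<in>A. \<integral>\<omega>. (y a t \<omega> - bank Z (R a) y t \<omega>)\<^sup>2 \<partial>M)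
        + (\<Sum>a\<in>A. \<integral>\<omega>. (q a t \<omega> - bank Z (R a) y t \<omega>)\<^sup>2 \<partial>M)"
      using l by (subst mse_eq_sum) (auto simp: pyth sum.distrib)
    ultimately show "mse M A y r t + (\<Sum>a\<in>A. \<integral>\<omega>. (q a t \<omega> - bank Z (R a) y t \<omega>)\<^sup>2 \<partial>M) \<le> mse M A y q t + \<epsilon>"
      by linarith
  qed
qed

end

theorem mainTheorem2:
  fixes M :: "'w measure"
    and \<nu> :: "'c::finite \<Rightarrow> 'v::finite" and \<mu> :: "'d::finite \<Rightarrow> 'v"
    and Q :: "'c \<Rightarrow> 'c \<Rightarrow> tf" and P :: "'c \<Rightarrow> 'd \<Rightarrow> tf"
    and u :: "'d \<Rightarrow> 'w process" and e y :: "'c \<Rightarrow> 'w process"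
    and E :: "('v \<times> 'v) set" and I Z J :: "'v set"
  assumes "ldim M \<nu> \<mu> Q P u e y"
    and "graphical_representation E \<nu> Q"
    and "I \<inter> Z = {}" and "I \<inter> J = {}" and "Z \<inter> J = {}"
    and "causal_ldim Q"
    and "causally_stable Q"
    and "dsep E I Z J"
  shows "cwsep M \<nu> y I Z J"
proof -
  interpret prob_space M using assms(1) unfolding ldim_def by blast
  have "wide_sense_stationary M y" using assms(1) unfolding ldim_def by blast
  note y = second_order_stationary[OF this]
  let ?S = "\<nu> -` (I \<union> Z)" and ?Z = "\<nu> -` Z" and ?J = "\<nu> -` J"
  have sep: "\<exists>R. (\<forall>a b. R a b summable_on UNIV) \<and> (\<forall>a b. causal (R a b)) \<and>
      (\<forall>a\<in>?J. \<forall>t. (\<integral>\<omega>. (y a t \<omega> - bank ?S (W a) y t \<omega>)\<^sup>2 \<partial>M)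
        = (\<integral>\<omega>. (y a t \<omega> - bank ?Z (R a) y t \<omega>)\<^sup>2 \<partial>M)
          + (\<integral>\<omega>. (bank ?S (W a) y t \<omega> - bank ?Z (R a) y t \<omega>)\<^sup>2 \<partial>M))"
    if W: "\<forall>a\<in>?J. \<forall>s\<in>?S. W a s \<in> causal_tf_set" for W
  proof -
    have "\<exists>R. (\<forall>b. R b summable_on UNIV) \<and> (\<forall>b. causal (R b)) \<and>
        (a \<in> ?J \<longrightarrow> (\<forall>t. (\<integral>\<omega>. (y a t \<omega> - bank ?S (W a) y t \<omega>)\<^sup>2 \<partial>M)
          = (\<integral>\<omega>. (y a t \<omega> - bank ?Z R y t \<omega>)\<^sup>2 \<partial>M)
            + (\<integral>\<omega>. (bank ?S (W a) y t \<omega> - bank ?Z R y t \<omega>)\<^sup>2 \<partial>M)))" for a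
    proof (cases "a \<in> ?J")
      case True
      have Wa: "W a s summable_on UNIV" "causal (W a s)" if "\<nu> s \<in> I \<union> Z" for s
      proof -
        have "W a s \<in> causal_tf_set" using W True that by blast
        then show "W a s summable_on UNIV" "causal (W a s)"
          by (simp_all add: causal_tf_set_def tf_set_summable)
      qed
      have "\<nu> a \<in> J" using True by simp
      then have "\<exists>R. (\<forall>b. R b summable_on UNIV) \<and> (\<forall>b. causal (R b)) \<and>
          (\<forall>t. (\<integral>\<omega>. (y a t \<omega> - bank ?S (W a) y t \<omega>)\<^sup>2 \<partial>M)
            = (\<integral>\<omega>. (y a t \<omega> - bank ?Z R y t \<omega>)\<^sup>2 \<partial>M)
              + (\<integral>\<omega>. (bank ?S (W a) y t \<omega> - bank ?Z R y t \<omega>)\<^sup>2 \<partial>M))"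
        by (rule ldim_separation[OF assms _ Wa])
      then show ?thesis by blast
    next
      case False
      \<comment> \<open>Outside \<open>?J\<close> any stable causal filter serves; the zero filter
        makes the subsequent choice total.\<close>
      then show ?thesis by (intro exI[of _ "\<lambda>_ _. 0"]) (simp add: causal_def)
    qed
    then have "\<forall>a. \<exists>R. (\<forall>b. R b summable_on UNIV) \<and> (\<forall>b. causal (R b)) \<and>
        (a \<in> ?J \<longrightarrow> (\<forall>t. (\<integral>\<omega>. (y a t \<omega> - bank ?S (W a) y t \<omega>)\<^sup>2 \<partial>M)
          = (\<integral>\<omega>. (y a t \<omega> - bank ?Z R y t \<omega>)\<^sup>2 \<partial>M)
            + (\<integral>\<omega>. (bank ?S (W a) y t \<omega> - bank ?Z R y t \<omega>)\<^sup>2 \<partial>M)))" by blast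
    then obtain R where R: "\<forall>a. (\<forall>b. R a b summable_on UNIV) \<and> (\<forall>b. causal (R a b)) \<and>
        (a \<in> ?J \<longrightarrow> (\<forall>t. (\<integral>\<omega>. (y a t \<omega> - bank ?S (W a) y t \<omega>)\<^sup>2 \<partial>M)
          = (\<integral>\<omega>. (y a t \<omega> - bank ?Z (R a) y t \<omega>)\<^sup>2 \<partial>M)
            + (\<integral>\<omega>. (bank ?S (W a) y t \<omega> - bank ?Z (R a) y t \<omega>)\<^sup>2 \<partial>M)))"
      by (rule choice[THEN exE])
    show ?thesis
      using R by (intro exI[of _ R]) blast
  qed
  have Wl: "\<forall>a\<in>?J. second_order M (bank ?S (W a) y)" if "\<forall>a\<in>?J. \<forall>s\<in>?S. W a s \<in> causal_tf_set" for W
  proof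
    fix a assume "a \<in> ?J"
    then have "bank ?S (W a) y \<in> ctfspan ?S y"
      unfolding ctfspan_bank using that by (intro exI[of _ "W a"]) blast
    then show "second_order M (bank ?S (W a) y)" by (rule second_order_ctfspan[OF y])
  qed
  show ?thesis
    unfolding cwsep_def
  proof (intro conjI allI impI ballI)
    fix \<Phi> W a b
    assume psd: "has_psd M y \<Phi>" "psd_pos_def_on ?S \<Phi>"
      and filter: "causal_wiener_filter M ?J y ?S y W" and a: "a \<in> ?J" and b: "b \<in> \<nu> -` I"
    have W: "\<forall>a\<in>?J. \<forall>s\<in>?S. W a s \<in> causal_tf_set"
      using filter by (simp add: causal_wiener_filter_def)
    obtain R where R: "\<And>a b. R a b summable_on UNIV" "\<And>a b. causal (R a b)"
      and pyth: "\<forall>a\<in>?J. \<forall>t. (\<integral>\<omega>. (y a t \<omega> - bank ?S (W a) y t \<omega>)\<^sup>2 \<partial>M)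
        = (\<integral>\<omega>. (y a t \<omega> - bank ?Z (R a) y t \<omega>)\<^sup>2 \<partial>M)
          + (\<integral>\<omega>. (bank ?S (W a) y t \<omega> - bank ?Z (R a) y t \<omega>)\<^sup>2 \<partial>M)"
      using sep[OF W] by blast
    have optimal: "mse M ?J y (\<lambda>a. bank ?S (W a) y) t \<le> mse M ?J y r t"
      if "\<forall>a. r a \<in> ctfspan ?Z y" for r t
    proof -
      have "\<forall>a\<in>?J. r a \<in> ctfspan ?S y"
        using that ctfspan_mono[of ?S ?Z y] by auto
      then show ?thesis
        using filter unfolding causal_wiener_filter_def causal_wiener_estimate_def bank_def by blast
    qed
    define h where "h t \<omega> = bank ?S (W a) y t \<omega> - bank ?Z (R a) y t \<omega>" for t \<omega>
    have h2: "l2 M (h t)" for t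
      unfolding h_def[abs_def] using Wl[OF W] a second_order_bank[of ?Z "R a" y] R y
      by (intro l2_diff second_order_l2) auto
    have h0: "AE \<omega> in M. h t \<omega> = 0" for t
    proof -
      let ?D = "\<lambda>a. \<integral>\<omega>. (bank ?S (W a) y t \<omega> - bank ?Z (R a) y t \<omega>)\<^sup>2 \<partial>M"
      \<comment> \<open>The rational \<open>r\<close> also competes among the estimates from the
        larger set, by zero filters on \<open>I\<close>. Its error is at most the optimal one minus
        the sum of the \<open>?D a\<close> plus \<epsilon>, so optimality bounds that sum by
        \<epsilon>.\<close>
      have "(\<Sum>a\<in>?J. ?D a) \<le> 0 + \<epsilon>" if eps: "\<epsilon> > 0" for \<epsilon>
      proof -
        obtain r where r: "\<forall>a. r a \<in> ctfspan ?Z y"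
          "\<And>t. mse M ?J y r t + (\<Sum>a\<in>?J. \<integral>\<omega>. (bank ?S (W a) y t \<omega> - bank ?Z (R a) y t \<omega>)\<^sup>2 \<partial>M)
            \<le> mse M ?J y (\<lambda>a. bank ?S (W a) y) t + \<epsilon>"
          using mse_rational_approximation[where q="\<lambda>a. bank ?S (W a) y", OF y R Wl[OF W] pyth eps] by blast
        from optimal[OF r(1), of t] r(2)[of t] show ?thesis by linarith
      qed
      then have "(\<Sum>a\<in>?J. ?D a) \<le> 0" by (rule field_le_epsilon)
      moreover have "?D a \<le> (\<Sum>a\<in>?J. ?D a)"
        using a by (intro member_le_sum) auto
      moreover have "?D a \<ge> 0" by simp
      ultimately have "?D a = 0" by linarith
      then have "(\<integral>\<omega>. (h t \<omega>)\<^sup>2 \<partial>M) = 0" by (simp only: h_def)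
      moreover have "integrable M (\<lambda>\<omega>. (h t \<omega>)\<^sup>2)" using h2 by (simp add: l2_def)
      ultimately have "AE \<omega> in M. (h t \<omega>)\<^sup>2 = 0"
        by (subst (asm) integral_nonneg_eq_0_iff_AE) auto
      then show ?thesis by simp
    qed
    \<comment> \<open>Extension by zero puts both filters on the same index set, so that uniqueness
      can compare them; on the components of \<open>I\<close> the extended filter is 0.\<close>
    define R' where "R' s = (if s \<in> ?Z then R a s else (\<lambda>_. 0))" for s
    have R's: "R' s summable_on UNIV" for s using R by (simp add: R'_def)
    have R'_bank: "bank ?S R' y = bank ?Z (R a) y"
    proof -
      have "bank ?S R' y = bank ?Z R' y" by (rule bank_mono_neutral) (auto simp: R'_def)
      then show ?thesis by (simp add: bank_def R'_def)
    qed
    have Ws: "W a s summable_on UNIV" if "s \<in> ?S" for s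
    proof -
      have "W a s \<in> causal_tf_set" using W a that by blast
      then show ?thesis by (simp add: causal_tf_set_def tf_set_summable)
    qed
    have "(\<lambda>k. W a b k - R' b k) = (\<lambda>_. 0)"
    proof (rule psd_pos_def_filter_unique[OF y psd, where g="\<lambda>s k. W a s k - R' s k"])
      show "AE \<omega> in M. bank ?S (\<lambda>s k. W a s k - R' s k) y t \<omega> = 0" for t
      proof -
        have "AE \<omega> in M. bank ?S (\<lambda>s k. W a s k - R' s k) y t \<omega> = bank ?S (W a) y t \<omega> - bank ?S R' y t \<omega>"
          using Ws R's y by (intro bank_diff_filter) auto
        with h0[of t] show ?thesis
          unfolding R'_bank by eventually_elim (simp add: h_def)
      qed
    qed (use b Ws R's in \<open>auto intro: summable_on_diff\<close>)
    moreover have "b \<notin> ?Z" using b assms(3) by auto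
    ultimately show "W a b = (\<lambda>_. 0)" by (simp add: R'_def fun_eq_iff)
  next
    fix q and \<epsilon> :: real
    assume q: "\<forall>a\<in>?J. q a \<in> ctfspan ?S y" and \<epsilon>: "0 < \<epsilon>"
    have "\<forall>a\<in>?J. \<exists>P. (\<forall>s\<in>?S. P s \<in> causal_tf_set) \<and> q a = bank ?S P y"
      using q by (simp add: ctfspan_bank)
    from bchoice[OF this] obtain W where W: "\<forall>a\<in>?J. \<forall>s\<in>?S. W a s \<in> causal_tf_set"
      and qW: "\<And>a. a \<in> ?J \<Longrightarrow> q a = bank ?S (W a) y" by blast
    obtain R where R: "\<And>a b. R a b summable_on UNIV" "\<And>a b. causal (R a b)"
      and pyth: "\<forall>a\<in>?J. \<forall>t. (\<integral>\<omega>. (y a t \<omega> - q a t \<omega>)\<^sup>2 \<partial>M)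
        = (\<integral>\<omega>. (y a t \<omega> - bank ?Z (R a) y t \<omega>)\<^sup>2 \<partial>M)
          + (\<integral>\<omega>. (q a t \<omega> - bank ?Z (R a) y t \<omega>)\<^sup>2 \<partial>M)"
      using sep[OF W] qW by auto
    have q2: "\<forall>a\<in>?J. second_order M (q a)"
    proof
      fix a assume "a \<in> ?J"
      then have "q a \<in> ctfspan ?S y" using q by blast
      then show "second_order M (q a)" by (rule second_order_ctfspan[OF y])
    qed
    obtain r where r: "\<And>a. r a \<in> ctfspan ?Z y"
      "\<And>t. mse M ?J y r t + (\<Sum>a\<in>?J. \<integral>\<omega>. (q a t \<omega> - bank ?Z (R a) y t \<omega>)\<^sup>2 \<partial>M) \<le> mse M ?J y q t + \<epsilon>"
      using mse_rational_approximation[OF y R q2 pyth \<epsilon>] by blast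
    \<comment> \<open>For an arbitrary estimate \<open>q\<close> the distance between
      \<open>q\<close> and the bank with filters \<open>R\<close> is simply discarded as
      nonnegative.\<close>
    have "mse M ?J y r t \<le> mse M ?J y q t + \<epsilon>" for t
    proof -
      have "0 \<le> (\<Sum>a\<in>?J. \<integral>\<omega>. (q a t \<omega> - bank ?Z (R a) y t \<omega>)\<^sup>2 \<partial>M)"
        by (intro sum_nonneg) simp
      with r(2)[of t] show ?thesis by linarith
    qed
    with r(1) show "\<exists>r. (\<forall>a\<in>?J. r a \<in> ctfspan ?Z y) \<and> (\<forall>t. mse M ?J y r t \<le> mse M ?J y q t + \<epsilon>)"
      by blast
  qed
qed

end
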